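(* $\mathsf{RCA}_0^\omega \vdash (\mathcal{U}_{\mathrm{idem}}) \rightarrow \mathsf{IHT}$. That is, the system $\mathsf{RCA}_0^\omega$ proves that if an idempotent non-principal ultrafilter on $\mathbb{N}$ exists, then the iterated Hindman's theorem holds.
   Context: **Types.** The set $\mathbf{T}$ of finite types is the smallest set with $0\in\mathbf{T}$ and $\rho,\tau\in\mathbf{T}\Rightarrow\tau(\rho)\in\mathbf{T}$. Type $0$ is the type of natural numbers, and $\tau(\rho)$ is the type of functions from $\rho$ to $\tau$. Write $1:=0(0)$ and $2:=0(0(0))$. Equality $=_0$ is primitive (with the usual equality axioms), and $x=_{\tau\rho}y$ abbreviates $\forall z^\rho\,(xz=_\tau yz)$. **Term system $T_0$.** It consists of the closed terms built from $0^0$, the successor function $S^1$, the $\lambda$-combinators $\Pi_{\rho,\sigma},\Sigma_{\rho,\sigma,\tau}$ of all types (with $\Pi xy=x$, $\Sigma xyz=xz(yz)$), and the recursor $R_0$ of type $0$, where in general $R_\rho 0yz=_\rho y$ and $R_\rho(Sx^0)yz=_\rho z(R_\rho xyz)x$. **$\mathsf{RCA}_0^\omega$.** This is the (classical, many-sorted) theory with the terms of $T_0$ and their defining equations, extended by $\Sigma^0_1$-induction, the extensionality axioms $\forall z^{\tau\rho},x^\rho,y^\rho\,(x=_\rho y\rightarrow zx=_\tau zy)$ for all $\rho,\tau\in\mathbf{T}$, and the schema $\mathsf{QF\text{-}AC}^{1,0}$: $\forall f^1\exists x^0 A(f,x)\rightarrow\exists F^2\forall f^1 A(f,F(f))$ for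 quantifier-free $A$. **Sets.** Type $1$ objects $X$ are viewed as characteristic functions of subsets of $\mathbb{N}$, with $n\in X$ meaning $X(n)=0$. Intersection $X\cap Y$ is the pointwise maximum, $\overline{X}$ is the complement, and $X-n:=\{m\in\mathbb{N}\mid m+n\in X\}$. Let $\mathrm{sg}(0)=0$ and $\mathrm{sg}(n)=1$ for $n>0$. For $\mathcal{U}$ of type $2$, $X\in\mathcal{U}$ means $\mathcal{U}(X)=_0 0$. **$(\mathcal{U}_{\mathrm{idem}})$.** This is the statement that there exists $\mathcal{U}^2$ such that: 1. $\forall X^1\,(X\in\mathcal{U}\vee\overline{X}\in\mathcal{U})$; 2. $\forall X^1,Y^1\,(X\cap Y\in\mathcal{U}\rightarrow Y\in\mathcal{U})$; 3. $\forall X^1,Y^1\,(X,Y\in\mathcal{U}\rightarrow X\cap Y\in\mathcal{U})$; 4. $\forall X^1\,(X\in\mathcal{U}\rightarrow\forall n\exists k>n\,(k\in X))$; 5. $\forall X^1\,(\mathcal{U}(X)=_0\mathrm{sg}(\mathcal{U}(X))=_0\mathcal{U}(\lambda n.\,\mathrm{sg}(X(n))))$; 6. $\forall X^1\,(X\in\mathcal{U}\rightarrow\{n\in\mathbb{N}\mid X-n\in\mathcal{U}\}\in\mathcal{U})$. **$\mathsf{IHT}$ (iterated Hindman's theorem).** For each sequence of colorings $c_k\colon\mathbb{N}\to 2$ ($k\in\mathbb{N}$) there exists a strictly ascending sequence $(x_i)_{i\in\mathbb{N}}$ of natural numbers such that for each $k$ the set $\mathrm{FS}((x_i)_{i=k}^\infty)$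 is homogeneous for $c_k$ (i.e. $c_k$ is constant on it). Here $\mathrm{FS}((x_i)_i):=\{x_{i_k}+\dots+x_{i_1}\mid i_1<i_2<\dots<i_k\}$ is the set of finite (nonempty) sums. *)

theory Defs
  imports Main
begin

text \<open>\<open>\<rho> \<rightarrow>\<^sub>t \<tau>\<close> is the type written \<open>\<tau>(\<rho>)\<close> in the literature.\<close>

datatype ty = N | Fn ty ty (infixr "\<rightarrow>\<^sub>t" 60)

abbreviation T1 :: ty where "T1 \<equiv> N \<rightarrow>\<^sub>t N"
abbreviation T2 :: ty where "T2 \<equiv> T1 \<rightarrow>\<^sub>t N"

text \<open>
  Variables are de Bruijn indices counted separately for every type: \<open>Var \<rho> i\<close> is bound by the
  \<open>i\<close>-th enclosing quantifier of type \<open>\<rho>\<close> (counting from 0, innermost first); quantifiers of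
  other types are skipped.  Thus every type has its own infinite supply of variables.
\<close>

datatype tm =
    Var ty nat
  | Zero
  | Succ
  | PiC ty ty
  | SigmaC ty ty ty
  | Rec
  | App tm tm (infixl "\<cdot>" 100)

text \<open>Prime formulas are equations of type 0 only.\<close>

datatype fm =
    Eq tm tm (infix "\<approx>" 75)
  | Bot
  | Imp fm fm (infixr "\<^bold>\<longrightarrow>" 55)
  | All ty fm

text \<open>The logic is classical, so the other connectives are taken as abbreviations.\<close>

definition Neg :: "fm \<Rightarrow> fm" where "Neg A = (A \<^bold>\<longrightarrow> Bot)"
definition Dis :: "fm \<Rightarrow> fm \<Rightarrow> fm" (infixr "\<^bold>\<or>" 60) where "A \<^bold>\<or> B = (Neg A \<^bold>\<longrightarrow> B)"
definition Con :: "fm \<Rightarrow> fm \<Rightarrow> fm" (infixr "\<^bold>\<and>" 65) where "A \<^bold>\<and> B = Neg (A \<^bold>\<longrightarrow> Neg B)"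
definition Ex :: "ty \<Rightarrow> fm \<Rightarrow> fm" where "Ex \<rho> A = Neg (All \<rho> (Neg A))"

text \<open>The value of \<open>ty_of\<close> is only meaningful on well-typed terms.\<close>

primrec ty_of :: "tm \<Rightarrow> ty" where
  "ty_of (Var \<rho> i) = \<rho>"
| "ty_of Zero = N"
| "ty_of Succ = N \<rightarrow>\<^sub>t N"
| "ty_of (PiC \<rho> \<sigma>) = \<rho> \<rightarrow>\<^sub>t \<sigma> \<rightarrow>\<^sub>t \<rho>"
| "ty_of (SigmaC \<rho> \<sigma> \<tau>) = (\<rho> \<rightarrow>\<^sub>t \<sigma> \<rightarrow>\<^sub>t \<tau>) \<rightarrow>\<^sub>t (\<rho> \<rightarrow>\<^sub>t \<sigma>) \<rightarrow>\<^sub>t \<rho> \<rightarrow>\<^sub>t \<tau>"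
| "ty_of Rec = N \<rightarrow>\<^sub>t N \<rightarrow>\<^sub>t (N \<rightarrow>\<^sub>t N \<rightarrow>\<^sub>t N) \<rightarrow>\<^sub>t N"
| "ty_of (s \<cdot> t) = (case ty_of s of N \<Rightarrow> N | Fn \<rho> \<tau> \<Rightarrow> \<tau>)"

primrec wt :: "tm \<Rightarrow> bool" where
  "wt (Var \<rho> i) = True"
| "wt Zero = True"
| "wt Succ = True"
| "wt (PiC \<rho> \<sigma>) = True"
| "wt (SigmaC \<rho> \<sigma> \<tau>) = True"
| "wt Rec = True"
| "wt (s \<cdot> t) = (wt s \<and> wt t \<and> (\<exists>\<tau>. ty_of s = (ty_of t \<rightarrow>\<^sub>t \<tau>)))"

definition has_ty :: "tm \<Rightarrow> ty \<Rightarrow> bool" (infix "\<Colon>" 50) where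
  "t \<Colon> \<tau> \<longleftrightarrow> wt t \<and> ty_of t = \<tau>"

primrec wff :: "fm \<Rightarrow> bool" where
  "wff (s \<approx> t) = (s \<Colon> N \<and> t \<Colon> N)"
| "wff Bot = True"
| "wff (A \<^bold>\<longrightarrow> B) = (wff A \<and> wff B)"
| "wff (All \<rho> A) = wff A"

primrec qfree :: "fm \<Rightarrow> bool" where
  "qfree (s \<approx> t) = True"
| "qfree Bot = True"
| "qfree (A \<^bold>\<longrightarrow> B) = (qfree A \<and> qfree B)"
| "qfree (All \<rho> A) = False"

type_synonym substitution = "ty \<Rightarrow> nat \<Rightarrow> tm"

primrec subst_tm :: "substitution \<Rightarrow> tm \<Rightarrow> tm" where
  "subst_tm \<theta> (Var \<rho> i) = \<theta> \<rho> i"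
| "subst_tm \<theta> Zero = Zero"
| "subst_tm \<theta> Succ = Succ"
| "subst_tm \<theta> (PiC \<rho> \<sigma>) = PiC \<rho> \<sigma>"
| "subst_tm \<theta> (SigmaC \<rho> \<sigma> \<tau>) = SigmaC \<rho> \<sigma> \<tau>"
| "subst_tm \<theta> Rec = Rec"
| "subst_tm \<theta> (s \<cdot> t) = subst_tm \<theta> s \<cdot> subst_tm \<theta> t"

definition shift :: "ty \<Rightarrow> substitution" where
  "shift \<rho> = (\<lambda>\<tau> i. Var \<tau> (if \<tau> = \<rho> then Suc i else i))"

text \<open>Make room for a new innermost variable of type \<open>\<rho>\<close>.\<close>

abbreviation lift_tm :: "ty \<Rightarrow> tm \<Rightarrow> tm" where
  "lift_tm \<rho> \<equiv> subst_tm (shift \<rho>)"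

definition under :: "ty \<Rightarrow> substitution \<Rightarrow> substitution" where
  "under \<rho> \<theta> = (\<lambda>\<tau> i. if \<tau> = \<rho>
     then (case i of 0 \<Rightarrow> Var \<rho> 0 | Suc j \<Rightarrow> lift_tm \<rho> (\<theta> \<rho> j))
     else lift_tm \<rho> (\<theta> \<tau> i))"

primrec subst_fm :: "substitution \<Rightarrow> fm \<Rightarrow> fm" where
  "subst_fm \<theta> (s \<approx> t) = (subst_tm \<theta> s \<approx> subst_tm \<theta> t)"
| "subst_fm \<theta> Bot = Bot"
| "subst_fm \<theta> (A \<^bold>\<longrightarrow> B) = (subst_fm \<theta> A \<^bold>\<longrightarrow> subst_fm \<theta> B)"
| "subst_fm \<theta> (All \<rho> A) = All \<rho> (subst_fm (under \<rho> \<theta>) A)"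

abbreviation lift_fm :: "ty \<Rightarrow> fm \<Rightarrow> fm" where
  "lift_fm \<rho> \<equiv> subst_fm (shift \<rho>)"

text \<open>\<open>inst_fm \<rho> t A\<close> replaces \<open>Var \<rho> 0\<close> by \<open>t\<close> and removes it from the list of free variables.\<close>

definition inst :: "ty \<Rightarrow> tm \<Rightarrow> substitution" where
  "inst \<rho> t = (\<lambda>\<tau> i. if \<tau> = \<rho> then (case i of 0 \<Rightarrow> t | Suc j \<Rightarrow> Var \<rho> j) else Var \<tau> i)"

abbreviation inst_fm :: "ty \<Rightarrow> tm \<Rightarrow> fm \<Rightarrow> fm" where
  "inst_fm \<rho> t \<equiv> subst_fm (inst \<rho> t)"

text \<open>In contrast, \<open>succ_fm A\<close> is \<open>A(n + 1)\<close> for \<open>n = Var N 0\<close>, which remains free.\<close>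

definition succ_fm :: "fm \<Rightarrow> fm" where
  "succ_fm A = subst_fm (\<lambda>\<tau> i. if \<tau> = N \<and> i = 0 then Succ \<cdot> Var N 0 else Var \<tau> i) A"

text \<open>
  \<open>T\<close> is a set of axioms which may contain free variables; as these are read universally, the
  axioms are exempt from the eigenvariable condition in \<open>allI\<close> (there expressed by lifting the
  hypotheses \<open>\<Gamma>\<close>).
\<close>

inductive derives :: "fm set \<Rightarrow> fm set \<Rightarrow> fm \<Rightarrow> bool" ("_; _ \<turnstile> _" [54, 54, 54] 53)
  for T :: "fm set" where
  axiom: "A \<in> T \<Longrightarrow> T; \<Gamma> \<turnstile> A"
| hyp: "A \<in> \<Gamma> \<Longrightarrow> T; \<Gamma> \<turnstile> A"
| impI: "wff A \<Longrightarrow> T; insert A \<Gamma> \<turnstile> B \<Longrightarrow> T; \<Gamma> \<turnstile> A \<^bold>\<longrightarrow> B"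
| impE: "T; \<Gamma> \<turnstile> A \<^bold>\<longrightarrow> B \<Longrightarrow> T; \<Gamma> \<turnstile> A \<Longrightarrow> T; \<Gamma> \<turnstile> B"
| raa: "wff A \<Longrightarrow> T; insert (Neg A) \<Gamma> \<turnstile> Bot \<Longrightarrow> T; \<Gamma> \<turnstile> A"
| allI: "T; lift_fm \<rho> ` \<Gamma> \<turnstile> A \<Longrightarrow> T; \<Gamma> \<turnstile> All \<rho> A"
| allE: "T; \<Gamma> \<turnstile> All \<rho> A \<Longrightarrow> t \<Colon> \<rho> \<Longrightarrow> T; \<Gamma> \<turnstile> inst_fm \<rho> t A"

definition proves :: "fm set \<Rightarrow> fm \<Rightarrow> bool" (infix "\<turnstile>" 53) where
  "T \<turnstile> A \<longleftrightarrow> T; {} \<turnstile> A"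

primrec eq_at :: "ty \<Rightarrow> tm \<Rightarrow> tm \<Rightarrow> fm" where
  "eq_at N s t = (s \<approx> t)"
| "eq_at (\<rho> \<rightarrow>\<^sub>t \<tau>) s t =
     All \<rho> (eq_at \<tau> (lift_tm \<rho> s \<cdot> Var \<rho> 0) (lift_tm \<rho> t \<cdot> Var \<rho> 0))"

text \<open>
  Axioms are given by all their term instances, with free variables as parameters.  The schema
  \<open>eq_subst\<close> together with \<open>eq_refl\<close> makes up the usual equality axioms for \<open>=\<^sub>0\<close>; equations between
  terms of higher type are the abbreviations \<open>eq_at\<close>.
\<close>

inductive_set RCA0_omega :: "fm set" where
  eq_refl: "s \<Colon> N \<Longrightarrow> (s \<approx> s) \<in> RCA0_omega"
| eq_subst: "s \<Colon> N \<Longrightarrow> t \<Colon> N \<Longrightarrow> wff A \<Longrightarrow>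
    ((s \<approx> t) \<^bold>\<longrightarrow> inst_fm N s A \<^bold>\<longrightarrow> inst_fm N t A) \<in> RCA0_omega"
| succ_nonzero: "s \<Colon> N \<Longrightarrow> Neg (Succ \<cdot> s \<approx> Zero) \<in> RCA0_omega"
| succ_inj: "s \<Colon> N \<Longrightarrow> t \<Colon> N \<Longrightarrow>
    ((Succ \<cdot> s \<approx> Succ \<cdot> t) \<^bold>\<longrightarrow> (s \<approx> t)) \<in> RCA0_omega"
| Pi_eq: "x \<Colon> \<rho> \<Longrightarrow> y \<Colon> \<sigma> \<Longrightarrow> eq_at \<rho> (PiC \<rho> \<sigma> \<cdot> x \<cdot> y) x \<in> RCA0_omega"
| Sigma_eq: "x \<Colon> \<rho> \<rightarrow>\<^sub>t \<sigma> \<rightarrow>\<^sub>t \<tau> \<Longrightarrow> y \<Colon> \<rho> \<rightarrow>\<^sub>t \<sigma> \<Longrightarrow> z \<Colon> \<rho> \<Longrightarrow>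
    eq_at \<tau> (SigmaC \<rho> \<sigma> \<tau> \<cdot> x \<cdot> y \<cdot> z) (x \<cdot> z \<cdot> (y \<cdot> z)) \<in> RCA0_omega"
| Rec_zero: "y \<Colon> N \<Longrightarrow> z \<Colon> N \<rightarrow>\<^sub>t N \<rightarrow>\<^sub>t N \<Longrightarrow>
    (Rec \<cdot> Zero \<cdot> y \<cdot> z \<approx> y) \<in> RCA0_omega"
| Rec_succ: "x \<Colon> N \<Longrightarrow> y \<Colon> N \<Longrightarrow> z \<Colon> N \<rightarrow>\<^sub>t N \<rightarrow>\<^sub>t N \<Longrightarrow>
    (Rec \<cdot> (Succ \<cdot> x) \<cdot> y \<cdot> z \<approx> z \<cdot> (Rec \<cdot> x \<cdot> y \<cdot> z) \<cdot> x) \<in> RCA0_omega"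
| extensionality: "z \<Colon> \<rho> \<rightarrow>\<^sub>t \<tau> \<Longrightarrow> x \<Colon> \<rho> \<Longrightarrow> y \<Colon> \<rho> \<Longrightarrow>
    (eq_at \<rho> x y \<^bold>\<longrightarrow> eq_at \<tau> (z \<cdot> x) (z \<cdot> y)) \<in> RCA0_omega"
| Sigma01_induction: "wff B \<Longrightarrow> qfree B \<Longrightarrow> A = Ex N B \<Longrightarrow>
    (inst_fm N Zero A \<^bold>\<longrightarrow> All N (A \<^bold>\<longrightarrow> succ_fm A) \<^bold>\<longrightarrow> All N A) \<in> RCA0_omega"
| QF_AC_1_0: "wff A \<Longrightarrow> qfree A \<Longrightarrow>
    (All T1 (Ex N A) \<^bold>\<longrightarrow>
     Ex T2 (All T1 (inst_fm N (Var T2 0 \<cdot> Var T1 0) (lift_fm T2 A)))) \<in> RCA0_omega"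

definition K :: "ty \<Rightarrow> tm \<Rightarrow> tm" where
  "K \<rho> t = PiC (ty_of t) \<rho> \<cdot> t"

text \<open>
  \<open>lam \<rho> t\<close> is the usual combinatory definition of \<open>\<lambda>x\<^sup>\<rho>. t\<close> where \<open>x = Var \<rho> 0\<close>.  Just like a
  quantifier of type \<open>\<rho>\<close>, it lowers the remaining indices of type \<open>\<rho>\<close> by one.
\<close>

primrec lam :: "ty \<Rightarrow> tm \<Rightarrow> tm" where
  "lam \<rho> (Var \<tau> i) = (if \<tau> = \<rho>
     then (case i of 0 \<Rightarrow> SigmaC \<rho> (\<rho> \<rightarrow>\<^sub>t \<rho>) \<rho> \<cdot> PiC \<rho> (\<rho> \<rightarrow>\<^sub>t \<rho>) \<cdot> PiC \<rho> \<rho> | Suc j \<Rightarrow> K \<rho> (Var \<rho> j))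
     else K \<rho> (Var \<tau> i))"
| "lam \<rho> Zero = K \<rho> Zero"
| "lam \<rho> Succ = K \<rho> Succ"
| "lam \<rho> (PiC \<sigma> \<tau>) = K \<rho> (PiC \<sigma> \<tau>)"
| "lam \<rho> (SigmaC \<sigma> \<tau> \<upsilon>) = K \<rho> (SigmaC \<sigma> \<tau> \<upsilon>)"
| "lam \<rho> Rec = K \<rho> Rec"
| "lam \<rho> (s \<cdot> t) = SigmaC \<rho> (ty_of t) (ty_of (s \<cdot> t)) \<cdot> lam \<rho> s \<cdot> lam \<rho> t"

definition add_tm :: "tm \<Rightarrow> tm \<Rightarrow> tm" where
  "add_tm s t = Rec \<cdot> t \<cdot> s \<cdot> lam N (lam N (Succ \<cdot> Var N 1))"

definition pred_tm :: "tm \<Rightarrow> tm" where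
  "pred_tm t = Rec \<cdot> t \<cdot> Zero \<cdot> lam N (lam N (Var N 0))"

definition monus_tm :: "tm \<Rightarrow> tm \<Rightarrow> tm" where
  "monus_tm s t = Rec \<cdot> t \<cdot> s \<cdot> lam N (lam N (pred_tm (Var N 1)))"

definition max_tm :: "tm \<Rightarrow> tm \<Rightarrow> tm" where
  "max_tm s t = add_tm s (monus_tm t s)"

definition sg :: "tm \<Rightarrow> tm" where
  "sg t = Rec \<cdot> t \<cdot> Zero \<cdot> lam N (lam N (Succ \<cdot> Zero))"

definition cosg :: "tm \<Rightarrow> tm" where
  "cosg t = Rec \<cdot> t \<cdot> (Succ \<cdot> Zero) \<cdot> lam N (lam N Zero)"

definition less_fm :: "tm \<Rightarrow> tm \<Rightarrow> fm" (infix "\<prec>" 75) where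
  "s \<prec> t = (monus_tm (Succ \<cdot> s) t \<approx> Zero)"

text \<open>\<open>sum_upto f l\<close> is \<open>f(0) + \<dots> + f(l)\<close>.\<close>

definition sum_upto :: "tm \<Rightarrow> tm \<Rightarrow> tm" where
  "sum_upto f l = Rec \<cdot> l \<cdot> (f \<cdot> Zero) \<cdot>
     lam N (lam N (add_tm (Var N 1) (lift_tm N (lift_tm N f) \<cdot> (Succ \<cdot> Var N 0))))"

text \<open>Used both for \<open>n \<in> X\<close> with \<open>X\<close> of type 1 and for \<open>X \<in> U\<close> with \<open>U\<close> of type 2.\<close>

definition mem :: "tm \<Rightarrow> tm \<Rightarrow> fm" (infix "\<epsilon>" 75) where
  "t \<epsilon> X = (X \<cdot> t \<approx> Zero)"

definition inter_set :: "tm \<Rightarrow> tm \<Rightarrow> tm" where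
  "inter_set X Y = lam N (max_tm (lift_tm N X \<cdot> Var N 0) (lift_tm N Y \<cdot> Var N 0))"

definition compl_set :: "tm \<Rightarrow> tm" where
  "compl_set X = lam N (cosg (lift_tm N X \<cdot> Var N 0))"

text \<open>\<open>translate X n\<close> is \<open>X - n\<close>, and at the same time the tail \<open>(x\<^sub>i)\<^sub>i\<^sub>\<ge>\<^sub>n\<close> of a sequence.\<close>

definition translate :: "tm \<Rightarrow> tm \<Rightarrow> tm" where
  "translate X n = lam N (lift_tm N X \<cdot> add_tm (Var N 0) (lift_tm N n))"

definition norm_set :: "tm \<Rightarrow> tm" where
  "norm_set X = lam N (sg (lift_tm N X \<cdot> Var N 0))"

text \<open>The set of all \<open>n\<close> with \<open>X - n \<in> U\<close>.\<close>

definition idem_set :: "tm \<Rightarrow> tm \<Rightarrow> tm" where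
  "idem_set U X = lam N (lift_tm N U \<cdot> translate (lift_tm N X) (Var N 0))"

text \<open>
  Under two quantifiers of type 1, the outer variable (\<open>X\<close>) is \<open>Var T1 1\<close>, the inner (\<open>Y\<close>) is
  \<open>Var T1 0\<close>.  In the fourth conjunct, \<open>n = Var N 1\<close> and \<open>k = Var N 0\<close>.
\<close>

definition U_idem :: fm where
  "U_idem = (let U = Var T2 0 in Ex T2 (
     All T1 (let X = Var T1 0 in X \<epsilon> U \<^bold>\<or> compl_set X \<epsilon> U) \<^bold>\<and>
     All T1 (All T1 (let X = Var T1 1; Y = Var T1 0 in inter_set X Y \<epsilon> U \<^bold>\<longrightarrow> Y \<epsilon> U)) \<^bold>\<and>
     All T1 (All T1 (let X = Var T1 1; Y = Var T1 0 in X \<epsilon> U \<^bold>\<and> Y \<epsilon> U \<^bold>\<longrightarrow> inter_set X Y \<epsilon> U)) \<^bold>\<and>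
     All T1 (let X = Var T1 0 in X \<epsilon> U \<^bold>\<longrightarrow> All N (Ex N (Var N 1 \<prec> Var N 0 \<^bold>\<and> Var N 0 \<epsilon> X))) \<^bold>\<and>
     All T1 (let X = Var T1 0 in (U \<cdot> X \<approx> sg (U \<cdot> X)) \<^bold>\<and> (sg (U \<cdot> X) \<approx> U \<cdot> norm_set X)) \<^bold>\<and>
     All T1 (let X = Var T1 0 in X \<epsilon> U \<^bold>\<longrightarrow> idem_set U X \<epsilon> U)))"

definition strictly_ascending :: "tm \<Rightarrow> fm" where
  "strictly_ascending x =
     (let x' = lift_tm N (lift_tm N x); i = Var N 1; j = Var N 0
      in All N (All N (i \<prec> j \<^bold>\<longrightarrow> x' \<cdot> i \<prec> x' \<cdot> j)))"

text \<open>
  \<open>y \<in> FS(x)\<close>: there are \<open>s\<close> of type 1 and \<open>l\<close> of type 0 with \<open>s(0) < \<dots> < s(l)\<close> and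
  \<open>y = x(s(0)) + \<dots> + x(s(l))\<close>.  So a finite nonempty sequence of indices is represented by an
  initial segment of a function, and the empty sum is excluded.
\<close>

definition in_FS :: "tm \<Rightarrow> tm \<Rightarrow> fm" where
  "in_FS y x =
     (let y' = lift_tm N (lift_tm T1 y); x' = lift_tm N (lift_tm T1 x);
          s = Var T1 0; l = Var N 0
      in Ex T1 (Ex N (
           All N (let j = Var N 0 in j \<prec> lift_tm N l \<^bold>\<longrightarrow> s \<cdot> j \<prec> s \<cdot> (Succ \<cdot> j)) \<^bold>\<and>
           (y' \<approx> sum_upto (lam N (lift_tm N x' \<cdot> (s \<cdot> Var N 0))) l))))"

text \<open>\<open>FS(x)\<close> is homogeneous for the coloring \<open>c\<close>, with color \<open>Var N 1\<close>.\<close>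

definition FS_homogeneous :: "tm \<Rightarrow> tm \<Rightarrow> fm" where
  "FS_homogeneous c x =
     (let c' = lift_tm N (lift_tm N c); x' = lift_tm N (lift_tm N x); y = Var N 0
      in Ex N (All N (in_FS y x' \<^bold>\<longrightarrow> (c' \<cdot> y \<approx> Var N 1))))"

definition IHT :: fm where
  "IHT = (let C = N \<rightarrow>\<^sub>t N \<rightarrow>\<^sub>t N; c = Var C 0; x = Var T1 0 in
     All C (
       All N (All N (let c_k_n = c \<cdot> Var N 1 \<cdot> Var N 0
                     in (c_k_n \<approx> Zero) \<^bold>\<or> (c_k_n \<approx> Succ \<cdot> Zero))) \<^bold>\<longrightarrow>
       Ex T1 (strictly_ascending x \<^bold>\<and>
              All N (let k = Var N 0 in FS_homogeneous (c \<cdot> k) (translate x k)))))"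

end

theory Submission
  imports Defs "HOL-Library.Countable"
begin

text \<open>
  A Henkin completeness theorem for the calculus reduces provability to truth in all extensional
  models of the axioms. In a model with an idempotent ultrafilter \<open>U\<close>, let \<open>A\<^sub>k \<in> U\<close> be a colour
  class of \<open>c\<^sub>k\<close> and \<open>A\<^sub>k\<^sup>* = {n \<in> A\<^sub>k. A\<^sub>k - n \<in> U}\<close>. Then \<open>A\<^sub>k\<^sup>* \<in> U\<close>, and \<open>A\<^sub>k\<^sup>* - v \<in> U\<close> for
  \<open>v \<in> A\<^sub>k\<^sup>*\<close>. Hence for every \<open>p\<close> the intersection of \<open>A\<^sub>k\<^sup>*\<close> and \<open>A\<^sub>k\<^sup>* - v\<close> over all \<open>k \<le> p\<close> and all
  \<open>v \<in> A\<^sub>k\<^sup>*\<close> with \<open>v \<le> p\<close> lies in \<open>U\<close> and contains some \<open>g(p) > p\<close>; \<open>g\<close> exists by \<open>QF-AC\<close>.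
  The sequence is \<open>x\<^sub>n = g(x\<^sub>0 + \<dots> + x\<^sub>n\<^sub>-\<^sub>1)\<close>. Admitting all \<open>v \<le> p\<close> instead of only the finite sums of
  earlier terms makes the state of the recursion a single number, so that \<open>R\<^sub>0\<close> suffices and
  no coding of finite sequences is needed.
\<close>

section \<open>Substitution\<close>

text \<open>The detour through models trades derivations about combinators and de Bruijn indices for
  ordinary reasoning. Its price is that a model may be nonstandard. Induction in it is available
  only for predicates defined by quantifier-free or Sigma01 formulas, so every induction below
  exhibits its formula and environment, and every function needed must be the value of a term or
  come from choice. Three facts keep these obligations small. Since U is an object of type 2,
  membership in U is an equation between numbers; closure of U under bounded intersections is
  therefore a quantifier-free induction, valid for nonstandard bounds too. For the same reason the
  recursor can decide whether a set lies in U, which selects the color classes uniformly in k.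
  Finally, by extensionality U takes equal values on pointwise equal functions, so a set may be
  represented by any element with the right values. The passage from a color class to its star is
  needed because the sums must stay in a set that can be extended again: knowing only that v lies in
  the color class does not put the translate by v into U.\<close>

definition wt_subst :: "substitution \<Rightarrow> bool" where
  "wt_subst \<theta> \<longleftrightarrow> (\<forall>\<tau> i. \<theta> \<tau> i \<Colon> \<tau>)"

text \<open>Polymorphic, because the same operation extends a substitution by a term and an
  environment of a model by an element.\<close>

definition push :: "ty \<Rightarrow> 'a \<Rightarrow> (ty \<Rightarrow> nat \<Rightarrow> 'a) \<Rightarrow> ty \<Rightarrow> nat \<Rightarrow> 'a" where
  "push \<rho> x e = (\<lambda>\<tau> i. if \<tau> = \<rho> then (case i of 0 \<Rightarrow> x | Suc j \<Rightarrow> e \<rho> j) else e \<tau> i)"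

lemma push_simps [simp]:
  "push \<rho> x e \<rho> 0 = x"
  "push \<rho> x e \<rho> (Suc j) = e \<rho> j"
  "\<tau> \<noteq> \<rho> \<Longrightarrow> push \<rho> x e \<tau> i = e \<tau> i"
  by (simp_all add: push_def)

lemma inst_push: "inst \<rho> t = push \<rho> t Var"
  by (auto simp: inst_def push_def fun_eq_iff split: nat.split)

lemma has_ty_simps [simp]:
  "Var \<rho> i \<Colon> \<tau> \<longleftrightarrow> \<tau> = \<rho>"
  "Zero \<Colon> \<tau> \<longleftrightarrow> \<tau> = N"
  "Succ \<Colon> \<tau> \<longleftrightarrow> \<tau> = T1"
  "PiC \<rho> \<sigma> \<Colon> \<tau> \<longleftrightarrow> \<tau> = ty_of (PiC \<rho> \<sigma>)"
  "SigmaC \<rho> \<sigma> \<upsilon> \<Colon> \<tau> \<longleftrightarrow> \<tau> = ty_of (SigmaC \<rho> \<sigma> \<upsilon>)"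
  "Rec \<Colon> \<tau> \<longleftrightarrow> \<tau> = ty_of Rec"
  by (auto simp: has_ty_def)

lemma has_ty_App: "s \<cdot> t \<Colon> \<tau> \<longleftrightarrow> (\<exists>\<rho>. s \<Colon> \<rho> \<rightarrow>\<^sub>t \<tau> \<and> t \<Colon> \<rho>)"
  by (auto simp: has_ty_def)

lemma has_ty_AppI: "s \<Colon> \<rho> \<rightarrow>\<^sub>t \<tau> \<Longrightarrow> t \<Colon> \<rho> \<Longrightarrow> s \<cdot> t \<Colon> \<tau>"
  by (auto simp: has_ty_App)

lemma subst_has_ty: "t \<Colon> \<tau> \<Longrightarrow> wt_subst \<theta> \<Longrightarrow> subst_tm \<theta> t \<Colon> \<tau>"
  by (induction t arbitrary: \<tau>) (auto simp: has_ty_App wt_subst_def)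

lemma wt_subst_shift [simp]: "wt_subst (shift \<rho>)"
  by (simp add: wt_subst_def shift_def)

lemma wt_subst_Var [simp]: "wt_subst Var"
  by (simp add: wt_subst_def)

lemma wt_subst_push: "t \<Colon> \<rho> \<Longrightarrow> wt_subst \<theta> \<Longrightarrow> wt_subst (push \<rho> t \<theta>)"
  by (auto simp: wt_subst_def push_def split: nat.split)

lemma wt_subst_inst: "t \<Colon> \<rho> \<Longrightarrow> wt_subst (inst \<rho> t)"
  by (simp add: inst_push wt_subst_push)

lemma wt_subst_under: "wt_subst \<theta> \<Longrightarrow> wt_subst (under \<rho> \<theta>)"
  using subst_has_ty[OF _ wt_subst_shift]
  by (auto simp: wt_subst_def under_def split: nat.split)

lemma subst_wff: "wff A \<Longrightarrow> wt_subst \<theta> \<Longrightarrow> wff (subst_fm \<theta> A)"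
  by (induction A arbitrary: \<theta>) (auto simp: subst_has_ty wt_subst_under)

lemma subst_qfree: "qfree A \<Longrightarrow> qfree (subst_fm \<theta> A)"
  by (induction A arbitrary: \<theta>) auto

lemma subst_tm_comp: "subst_tm \<theta> (subst_tm \<eta> t) = subst_tm (\<lambda>\<tau> i. subst_tm \<theta> (\<eta> \<tau> i)) t"
  by (induction t) auto

lemma subst_tm_Var [simp]: "subst_tm Var t = t"
  by (induction t) auto

lemma subst_under_lift: "subst_tm (under \<rho> \<theta>) (lift_tm \<rho> t) = lift_tm \<rho> (subst_tm \<theta> t)"
  unfolding subst_tm_comp
  by (rule arg_cong[where f = "\<lambda>\<theta>. subst_tm \<theta> t"]) (auto simp: shift_def under_def fun_eq_iff)

lemma subst_push_lift: "subst_tm (push \<rho> s \<theta>) (lift_tm \<rho> t) = subst_tm \<theta> t"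
  unfolding subst_tm_comp
  by (rule arg_cong[where f = "\<lambda>\<theta>. subst_tm \<theta> t"]) (auto simp: shift_def push_def fun_eq_iff)

lemma inst_lift [simp]: "subst_tm (inst \<rho> s) (lift_tm \<rho> t) = t"
  by (simp add: inst_push subst_push_lift)

lemma under_comp:
  "(\<lambda>\<tau> i. subst_tm (under \<rho> \<theta>) (under \<rho> \<eta> \<tau> i)) = under \<rho> (\<lambda>\<tau> i. subst_tm \<theta> (\<eta> \<tau> i))"
  by (auto simp: fun_eq_iff under_def[of \<rho> \<eta>] under_def[of \<rho> "\<lambda>\<tau> i. subst_tm \<theta> (\<eta> \<tau> i)"]
      subst_under_lift split: nat.split) (simp add: under_def)

lemma subst_fm_comp: "subst_fm \<theta> (subst_fm \<eta> A) = subst_fm (\<lambda>\<tau> i. subst_tm \<theta> (\<eta> \<tau> i)) A"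
  by (induction A arbitrary: \<theta> \<eta>) (auto simp: subst_tm_comp under_comp)

lemma under_Var [simp]: "under \<rho> Var = Var"
  by (auto simp: under_def fun_eq_iff shift_def split: nat.split)

lemma subst_fm_Var [simp]: "subst_fm Var A = A"
  by (induction A) auto

lemma inst_under: "subst_tm (inst \<rho> t) (under \<rho> \<theta> \<tau> i) = push \<rho> t \<theta> \<tau> i"
  by (auto simp: under_def push_def split: nat.split) (auto simp: inst_def)

text \<open>This is how the truth lemma treats a quantifier: a substitution under the binder
  followed by an instance is one extended substitution.\<close>

lemma inst_under_push: "inst_fm \<rho> t (subst_fm (under \<rho> \<theta>) A) = subst_fm (push \<rho> t \<theta>) A"
  unfolding subst_fm_comp inst_under ..

lemma subst_inst: "subst_fm \<theta> (inst_fm \<rho> t A) = inst_fm \<rho> (subst_tm \<theta> t) (subst_fm (under \<rho> \<theta>) A)"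
  unfolding inst_under_push unfolding subst_fm_comp
  by (rule arg_cong[where f = "\<lambda>\<theta>. subst_fm \<theta> A"])
    (auto simp: push_def inst_def fun_eq_iff split: nat.split)

lemma under_0 [simp]: "under \<rho> \<theta> \<rho> 0 = Var \<rho> 0"
  by (simp add: under_def)

lemma subst_eq_at: "subst_fm \<theta> (eq_at \<rho> s t) = eq_at \<rho> (subst_tm \<theta> s) (subst_tm \<theta> t)"
  by (induction \<rho> arbitrary: s t \<theta>) (auto simp: subst_under_lift)

lemma wff_eq_at: "s \<Colon> \<rho> \<Longrightarrow> t \<Colon> \<rho> \<Longrightarrow> wff (eq_at \<rho> s t)"
proof (induction \<rho> arbitrary: s t)
  case (Fn \<rho> \<tau>)
  have "lift_tm \<rho> u \<cdot> Var \<rho> 0 \<Colon> \<tau>" if "u \<Colon> \<rho> \<rightarrow>\<^sub>t \<tau>" for u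
    using subst_has_ty[OF that wt_subst_shift] by (auto simp: has_ty_App)
  with Fn show ?case by simp
qed simp

lemma subst_defs [simp]:
  "subst_fm \<theta> (Neg A) = Neg (subst_fm \<theta> A)"
  "subst_fm \<theta> (Ex \<rho> A) = Ex \<rho> (subst_fm (under \<rho> \<theta>) A)"
  by (auto simp: Neg_def Ex_def)

lemma wff_defs [simp]:
  "wff (Neg A) = wff A"
  "wff (Ex \<rho> A) = wff A"
  "wff (A \<^bold>\<and> B) = (wff A \<and> wff B)"
  "wff (A \<^bold>\<or> B) = (wff A \<and> wff B)"
  by (auto simp: Neg_def Ex_def Con_def Dis_def)

lemma RCA0_omega_wff: "A \<in> RCA0_omega \<Longrightarrow> wff A"
proof (induction rule: RCA0_omega.induct)
  case (Pi_eq x \<rho> y \<sigma>)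
  then show ?case by (auto intro!: wff_eq_at simp: has_ty_App)
next
  case (Sigma_eq x \<rho> \<sigma> \<tau> y z)
  then show ?case by (force intro!: wff_eq_at simp: has_ty_App)
next
  case (extensionality z \<rho> \<tau> x y)
  then show ?case by (auto intro!: wff_eq_at simp: has_ty_App)
next
  case (Sigma01_induction B A)
  then show ?case by (auto simp: succ_fm_def intro!: subst_wff wt_subst_under wt_subst_inst)
     (auto simp: wt_subst_def has_ty_App)
next
  case (QF_AC_1_0 A)
  then show ?case by (auto intro!: subst_wff wt_subst_inst simp: has_ty_App)
qed (auto intro!: subst_wff wt_subst_inst simp: has_ty_App)

lemma subst_succ_fm: "subst_fm (under N \<theta>) (succ_fm A) = succ_fm (subst_fm (under N \<theta>) A)"
  unfolding succ_fm_def subst_fm_comp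
  by (rule arg_cong[where f = "\<lambda>\<theta>. subst_fm \<theta> A"])
    (auto simp: under_def fun_eq_iff subst_tm_comp shift_def split: nat.split intro!: arg_cong2[of _ _ _ _ subst_tm])

text \<open>The choice axiom binds in different orders on its two sides: a substitution reaches the
  conclusion below the binders of F and f, but reaches \<open>A\<close> in the premise below those
  of f and x.\<close>

lemma subst_AC_matrix:
  "subst_fm (under T1 (under T2 \<theta>)) (inst_fm N (Var T2 0 \<cdot> Var T1 0) (lift_fm T2 A))
    = inst_fm N (Var T2 0 \<cdot> Var T1 0) (lift_fm T2 (subst_fm (under N (under T1 \<theta>)) A))"
  unfolding subst_fm_comp
  by (rule arg_cong[where f = "\<lambda>\<theta>. subst_fm \<theta> A"])
    (auto simp: under_def fun_eq_iff subst_tm_comp shift_def inst_def split: nat.split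
      intro!: arg_cong2[of _ _ _ _ subst_tm])

text \<open>Axioms have free variables that are read universally. Renaming an eigenvariable inside a
  derivation is possible only because substitution instances of axioms are again axioms; validity of
  the axioms in the term model rests on the same fact.\<close>

lemma RCA0_omega_subst: "A \<in> RCA0_omega \<Longrightarrow> wt_subst \<theta> \<Longrightarrow> subst_fm \<theta> A \<in> RCA0_omega"
proof (induction rule: RCA0_omega.induct)
  case (eq_subst s t A)
  then show ?case
    by (auto simp: subst_inst intro!: RCA0_omega.eq_subst subst_has_ty subst_wff wt_subst_under)
next
  case (Sigma01_induction B A)
  have "subst_fm (under N \<theta>) A = Ex N (subst_fm (under N (under N \<theta>)) B)"
    using Sigma01_induction by simp
  from RCA0_omega.Sigma01_induction[OF _ _ this] Sigma01_induction show ?case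
    by (simp add: subst_succ_fm subst_inst subst_wff subst_qfree wt_subst_under del: subst_defs)
next
  case (QF_AC_1_0 A)
  from RCA0_omega.QF_AC_1_0[of "subst_fm (under N (under T1 \<theta>)) A"] QF_AC_1_0 show ?case
    by (simp add: subst_AC_matrix subst_wff subst_qfree wt_subst_under)
next
  case (Pi_eq x \<rho> y \<sigma>)
  then show ?case by (auto simp: subst_eq_at intro!: RCA0_omega.intros subst_has_ty)
next
  case (Sigma_eq x \<rho> \<sigma> \<tau> y z)
  then show ?case by (auto simp: subst_eq_at intro!: RCA0_omega.intros subst_has_ty)
next
  case (extensionality z \<rho> \<tau> x y)
  then show ?case by (auto simp: subst_eq_at intro!: RCA0_omega.extensionality[where \<rho>=\<rho>] subst_has_ty)
qed (auto intro!: RCA0_omega.intros subst_has_ty)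

section \<open>Derivations\<close>

lemma derives_weaken: "T; \<Gamma> \<turnstile> A \<Longrightarrow> \<Gamma> \<subseteq> \<Delta> \<Longrightarrow> T; \<Delta> \<turnstile> A"
proof (induction arbitrary: \<Delta> rule: derives.induct)
  case (impI A \<Gamma> B)
  then show ?case by (metis derives.impI insert_mono)
next
  case (raa A \<Gamma>)
  then show ?case by (metis derives.raa insert_mono)
next
  case (allI \<rho> \<Gamma> A)
  then show ?case by (metis derives.allI image_mono)
qed (auto intro: derives.intros)

lemma derives_subst:
  assumes "T; \<Gamma> \<turnstile> A" and T: "\<And>A \<theta>. A \<in> T \<Longrightarrow> wt_subst \<theta> \<Longrightarrow> subst_fm \<theta> A \<in> T"
  shows "wt_subst \<theta> \<Longrightarrow> T; subst_fm \<theta> ` \<Gamma> \<turnstile> subst_fm \<theta> A"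
  using assms(1)
proof (induction arbitrary: \<theta> rule: derives.induct)
  case (impI A \<Gamma> B)
  then show ?case using derives.impI[of "subst_fm \<theta> A"] by (simp add: subst_wff)
next
  case (impE \<Gamma> A B)
  then show ?case by (auto intro: derives.impE)
next
  case (raa A \<Gamma>)
  then show ?case using derives.raa[of "subst_fm \<theta> A"] by (simp add: subst_wff)
next
  case (allI \<rho> \<Gamma> A)
  \<comment> \<open>Lifting the hypotheses commutes with the substitution, so the encoded
    eigenvariable condition survives it.\<close>
  have "subst_fm (under \<rho> \<theta>) ` lift_fm \<rho> ` \<Gamma> = lift_fm \<rho> ` subst_fm \<theta> ` \<Gamma>"
    unfolding image_image subst_fm_comp
    by (intro image_cong refl arg_cong2[of _ _ _ _ subst_fm])
      (auto simp: shift_def under_def fun_eq_iff)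
  with allI.IH[OF wt_subst_under[OF allI.prems, of \<rho>]]
  have "T; lift_fm \<rho> ` subst_fm \<theta> ` \<Gamma> \<turnstile> subst_fm (under \<rho> \<theta>) A" by (simp only:)
  then show ?case by (simp add: derives.allI)
next
  case (allE \<Gamma> \<rho> A t)
  then show ?case
    unfolding subst_inst by (auto intro!: derives.allE subst_has_ty)
next
  case (axiom A)
  then show ?case by (auto intro: derives.axiom T)
next
  case (hyp A)
  then show ?case by (auto intro: derives.hyp)
qed

section \<open>Free variables and generalization over a fresh variable\<close>

primrec fv_tm :: "tm \<Rightarrow> (ty \<times> nat) set" where
  "fv_tm (Var \<rho> i) = {(\<rho>, i)}"
| "fv_tm Zero = {}"
| "fv_tm Succ = {}"
| "fv_tm (PiC \<rho> \<sigma>) = {}"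
| "fv_tm (SigmaC \<rho> \<sigma> \<tau>) = {}"
| "fv_tm Rec = {}"
| "fv_tm (s \<cdot> t) = fv_tm s \<union> fv_tm t"

primrec fv_fm :: "fm \<Rightarrow> (ty \<times> nat) set" where
  "fv_fm (s \<approx> t) = fv_tm s \<union> fv_tm t"
| "fv_fm Bot = {}"
| "fv_fm (A \<^bold>\<longrightarrow> B) = fv_fm A \<union> fv_fm B"
| "fv_fm (All \<rho> A) = {(\<tau>, i). (\<tau>, if \<tau> = \<rho> then Suc i else i) \<in> fv_fm A}"

lemma finite_fv_tm: "finite (fv_tm t)"
  by (induction t) auto

lemma finite_fv_fm: "finite (fv_fm A)"
proof (induction A)
  case (All \<rho> A)
  have "fv_fm (All \<rho> A) = (\<lambda>(\<tau>, i). (\<tau>, if \<tau> = \<rho> then Suc i else i)) -` fv_fm A"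
    by auto
  then show ?case
    using All by (auto simp: inj_on_def split: if_splits intro!: finite_vimageI)
qed (auto simp: finite_fv_tm)

lemma subst_tm_cong: "(\<And>\<tau> i. (\<tau>, i) \<in> fv_tm t \<Longrightarrow> \<theta> \<tau> i = \<eta> \<tau> i) \<Longrightarrow> subst_tm \<theta> t = subst_tm \<eta> t"
  by (induction t) auto

lemma subst_fm_cong: "(\<And>\<tau> i. (\<tau>, i) \<in> fv_fm A \<Longrightarrow> \<theta> \<tau> i = \<eta> \<tau> i) \<Longrightarrow> subst_fm \<theta> A = subst_fm \<eta> A"
proof (induction A arbitrary: \<theta> \<eta>)
  case (Eq s t)
  then show ?case by (auto intro!: subst_tm_cong)
next
  case (Imp A B)
  from Imp.IH(1)[of \<theta> \<eta>] Imp.IH(2)[of \<theta> \<eta>] Imp.prems show ?case by simp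
next
  case (All \<rho> A)
  then have "\<theta> \<tau> i = \<eta> \<tau> i" if "(\<tau>, if \<tau> = \<rho> then Suc i else i) \<in> fv_fm A" for \<tau> i
    using that by simp
  then have "subst_fm (under \<rho> \<theta>) A = subst_fm (under \<rho> \<eta>) A"
    by (intro All.IH) (auto simp: under_def split: nat.split)
  then show ?case by simp
qed simp

text \<open>The renaming that turns \<open>i\<close> into 0 and shifts everything else reduces the eigenvariable rule
  for a fresh variable to the rule with lifted hypotheses.\<close>

lemma derives_generalize:
  assumes der: "T; \<Gamma> \<turnstile> inst_fm \<rho> (Var \<rho> i) A"
    and T: "\<And>A \<theta>. A \<in> T \<Longrightarrow> wt_subst \<theta> \<Longrightarrow> subst_fm \<theta> A \<in> T"
    and fresh: "\<And>B. B \<in> \<Gamma> \<Longrightarrow> (\<rho>, i) \<notin> fv_fm B" "(\<rho>, i) \<notin> fv_fm (All \<rho> A)"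
  shows "T; \<Gamma> \<turnstile> All \<rho> A"
proof -
  define \<theta> where "\<theta> = (\<lambda>\<tau> j. if \<tau> = \<rho> \<and> j = i then Var \<rho> 0 else shift \<rho> \<tau> j)"
  have wt: "wt_subst \<theta>"
    by (simp add: \<theta>_def wt_subst_def shift_def)
  have "subst_fm \<theta> B = lift_fm \<rho> B" if "B \<in> \<Gamma>" for B
    by (rule subst_fm_cong) (use fresh(1)[OF that] in \<open>auto simp: \<theta>_def\<close>)
  then have "subst_fm \<theta> ` \<Gamma> = lift_fm \<rho> ` \<Gamma>"
    by (intro image_cong refl)
  moreover have "subst_fm \<theta> (inst_fm \<rho> (Var \<rho> i) A) = A"
  proof -
    have "subst_fm \<theta> (inst_fm \<rho> (Var \<rho> i) A) = subst_fm Var A"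
      unfolding subst_fm_comp
      by (rule subst_fm_cong)
        (use fresh(2) in \<open>auto simp: \<theta>_def inst_def shift_def split: nat.split\<close>)
    then show ?thesis by simp
  qed
  ultimately show ?thesis
    using derives_subst[OF der T wt] by (auto intro: derives.allI)
qed

section \<open>Maximal consistent sets\<close>

text \<open>Countability provides the enumeration of formulas along which a maximal consistent set
  is built.\<close>

instance ty :: countable by countable_datatype
instance tm :: countable by countable_datatype
instance fm :: countable by countable_datatype

text \<open>One step of the Lindenbaum-Henkin construction. As the set is finite, some variable of
  the right type occurs nowhere in it, and this variable serves as the witness of a rejected
  universal formula; no new constants are required. If adding the witness were inconsistent,
  generalization would derive the universal formula itself.\<close>

lemma consistent_extend:
  assumes T: "\<And>A \<theta>. A \<in> T \<Longrightarrow> wt_subst \<theta> \<Longrightarrow> subst_fm \<theta> A \<in> T"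
    and \<Gamma>: "finite \<Gamma>" "\<not> T; \<Gamma> \<turnstile> Bot" and A: "wff A"
  shows "\<exists>\<Delta>. \<Gamma> \<subseteq> \<Delta> \<and> finite \<Delta> \<and> \<not> T; \<Delta> \<turnstile> Bot \<and> (A \<in> \<Delta> \<or> Neg A \<in> \<Delta>) \<and>
    (\<forall>\<rho> B. A = All \<rho> B \<longrightarrow> A \<in> \<Delta> \<or> (\<exists>i. Neg (inst_fm \<rho> (Var \<rho> i) B) \<in> \<Delta>))"
proof (cases "T; insert A \<Gamma> \<turnstile> Bot")
  case False
  then show ?thesis using \<Gamma>(1) by (intro exI[of _ "insert A \<Gamma>"]) auto
next
  case True
  then have neg: "T; \<Gamma> \<turnstile> Neg A"
    using A by (simp add: Neg_def derives.impI)
  have cons: "\<not> T; insert (Neg A) \<Gamma> \<turnstile> Bot"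
  proof
    assume "T; insert (Neg A) \<Gamma> \<turnstile> Bot"
    then have "T; \<Gamma> \<turnstile> A" by (rule derives.raa[OF A])
    with neg \<Gamma>(2) show False by (auto simp: Neg_def dest: derives.impE)
  qed
  show ?thesis
  proof (cases "\<exists>\<rho> B. A = All \<rho> B")
    case False
    then show ?thesis using \<Gamma>(1) cons by (intro exI[of _ "insert (Neg A) \<Gamma>"]) auto
  next
    case True
    then obtain \<rho> B where AB: "A = All \<rho> B" by blast
    let ?\<Delta> = "insert (Neg A) \<Gamma>"
    have "finite (\<Union>C\<in>?\<Delta> \<union> {A}. fv_fm C)" (is "finite ?F")
      using \<Gamma>(1) finite_fv_fm by blast
    then have "finite (Pair \<rho> -` ?F)" by (rule finite_vimageI) (auto simp: inj_on_def)
    then obtain i where "i \<notin> Pair \<rho> -` ?F"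
      using ex_new_if_finite[OF infinite_UNIV_nat] by blast
    then have fresh: "(\<rho>, i) \<notin> fv_fm C" if "C \<in> ?\<Delta> \<union> {A}" for C using that by blast
    have "\<not> T; insert (Neg (inst_fm \<rho> (Var \<rho> i) B)) ?\<Delta> \<turnstile> Bot"
    proof
      assume "T; insert (Neg (inst_fm \<rho> (Var \<rho> i) B)) ?\<Delta> \<turnstile> Bot"
      then have "T; ?\<Delta> \<turnstile> inst_fm \<rho> (Var \<rho> i) B"
        by (rule derives.raa[rotated]) (use A AB in \<open>auto intro!: subst_wff wt_subst_inst\<close>)
      then have "T; ?\<Delta> \<turnstile> A"
        unfolding AB by (rule derives_generalize[OF _ T]) (use fresh[of A] fresh AB in auto)
      moreover have "T; ?\<Delta> \<turnstile> Neg A" by (auto intro: derives.hyp)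
      ultimately show False using cons by (auto simp: Neg_def dest: derives.impE)
    qed
    then show ?thesis using \<Gamma>(1) AB
      by (intro exI[of _ "insert (Neg (inst_fm \<rho> (Var \<rho> i) B)) ?\<Delta>"]) auto
  qed
qed

text \<open>Membership in \<open>Th\<close> obeys the clauses of truth, with quantifiers ranging
  over all well-typed terms, open ones included.\<close>

locale henkin_set =
  fixes Th :: "fm set"
  assumes Imp_iff: "wff A \<Longrightarrow> wff B \<Longrightarrow> (A \<^bold>\<longrightarrow> B) \<in> Th \<longleftrightarrow> (A \<in> Th \<longrightarrow> B \<in> Th)"
    and Bot_notin: "Bot \<notin> Th"
    and All_iff: "wff A \<Longrightarrow> All \<rho> A \<in> Th \<longleftrightarrow> (\<forall>t. t \<Colon> \<rho> \<longrightarrow> inst_fm \<rho> t A \<in> Th)"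
    and axioms: "A \<in> RCA0_omega \<Longrightarrow> A \<in> Th"

lemma henkin_set_exists:
  assumes "\<not> RCA0_omega; {A} \<turnstile> Bot" and A: "wff A"
  shows "\<exists>Th. henkin_set Th \<and> A \<in> Th"
proof -
  let ?T = RCA0_omega
  define P where "P = (\<lambda>\<Delta>. finite \<Delta> \<and> \<not> ?T; \<Delta> \<turnstile> Bot \<and> A \<in> \<Delta>)"
  define Q where "Q = (\<lambda>B \<Gamma> \<Delta>. \<Gamma> \<subseteq> \<Delta> \<and> (wff B \<longrightarrow> (B \<in> \<Delta> \<or> Neg B \<in> \<Delta>) \<and>
    (\<forall>\<rho> C. B = All \<rho> C \<longrightarrow> B \<in> \<Delta> \<or> (\<exists>i. Neg (inst_fm \<rho> (Var \<rho> i) C) \<in> \<Delta>))))"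
  have step: "\<exists>\<Delta>. P \<Delta> \<and> Q B \<Gamma> \<Delta>" if "P \<Gamma>" for B \<Gamma>
  proof (cases "wff B")
    case True
    from consistent_extend[OF RCA0_omega_subst _ _ this, of \<Gamma>] that
    obtain \<Delta> where "\<Gamma> \<subseteq> \<Delta>" "finite \<Delta>" "\<not> ?T; \<Delta> \<turnstile> Bot" "B \<in> \<Delta> \<or> Neg B \<in> \<Delta>"
      "\<forall>\<rho> C. B = All \<rho> C \<longrightarrow> B \<in> \<Delta> \<or> (\<exists>i. Neg (inst_fm \<rho> (Var \<rho> i) C) \<in> \<Delta>)"
      unfolding P_def by blast
    then show ?thesis using that by (intro exI[of _ \<Delta>]) (auto simp: P_def Q_def)
  next
    case False
    then show ?thesis using that by (auto simp: Q_def)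
  qed
  have "P {A}" using assms by (simp add: P_def)
  \<comment> \<open>Stage n + 1 decides the n-th formula. All stages remain finite, which keeps
    fresh variables available.\<close>
  have "\<exists>G. \<forall>n. P (G n) \<and> Q (from_nat n) (G n) (G (Suc n))"
    by (rule dependent_nat_choice[of "\<lambda>_. P" "\<lambda>n. Q (from_nat n)"])
      (use step \<open>P {A}\<close> in \<open>blast+\<close>)
  then obtain G :: "nat \<Rightarrow> fm set" where
    PQ: "\<forall>n. P (G n) \<and> Q (from_nat n) (G n) (G (Suc n))" ..
  have P: "finite (G n)" "\<not> ?T; G n \<turnstile> Bot" "A \<in> G n" for n
    using spec[OF PQ, of n] by (simp_all add: P_def)
  have sub: "G n \<subseteq> G (Suc n)" for n
    using spec[OF PQ, of n] by (simp add: Q_def)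
  have mono: "G m \<subseteq> G n" if "m \<le> n" for m n
    using sub that by (rule lift_Suc_mono_le[of G])
  define Th where "Th = (\<Union>n. G n)"
  have decide: "B \<in> G (Suc (to_nat B)) \<or> Neg B \<in> G (Suc (to_nat B))" if "wff B" for B
    using spec[OF PQ, of "to_nat B"] that by (simp add: Q_def)
  \<comment> \<open>Otherwise the stage deciding \<open>B\<close> would have accepted its negation,
    and a later consistent stage would contain that negation and also derive
    \<open>B\<close>.\<close>
  have ded: "B \<in> Th" if "?T; \<Delta> \<turnstile> B" "\<Delta> \<subseteq> G n" "wff B" for B \<Delta> n
  proof (rule ccontr)
    assume "B \<notin> Th"
    let ?m = "max n (Suc (to_nat B))"
    from \<open>B \<notin> Th\<close> have "Neg B \<in> G ?m"
      using decide[OF that(3)] mono[of "Suc (to_nat B)" ?m] unfolding Th_def by auto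
    then have "?T; G ?m \<turnstile> Neg B" by (rule derives.hyp)
    moreover have "?T; G ?m \<turnstile> B"
      using that(1) by (rule derives_weaken) (use that(2) mono[of n ?m] in auto)
    ultimately show False using P[of ?m] by (auto simp: Neg_def dest: derives.impE)
  qed
  have neg: "Neg B \<in> Th \<longleftrightarrow> B \<notin> Th" if "wff B" for B
  proof
    assume "Neg B \<in> Th"
    then obtain m where m: "Neg B \<in> G m" by (auto simp: Th_def)
    show "B \<notin> Th"
    proof
      assume "B \<in> Th"
      then obtain n where n: "B \<in> G n" by (auto simp: Th_def)
      have "Neg B \<in> G (max m n)" "B \<in> G (max m n)"
        using m n mono[of m "max m n"] mono[of n "max m n"] by auto
      then show False
        using P[of "max m n"] by (auto simp: Neg_def intro: derives.impE derives.hyp)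
    qed
  next
    assume "B \<notin> Th"
    then show "Neg B \<in> Th" using decide[OF that] by (auto simp: Th_def)
  qed
  have closed: "B \<in> Th" if "?T; \<Delta> \<turnstile> B" "\<Delta> \<subseteq> Th" "finite \<Delta>" "wff B" for B \<Delta>
  proof -
    have "\<exists>n. \<Delta> \<subseteq> G n" using that(3,2)
    proof (induction rule: finite_induct)
      case (insert C \<Delta>)
      then obtain m n where "\<Delta> \<subseteq> G n" "C \<in> G m" by (auto simp: Th_def)
      then have "insert C \<Delta> \<subseteq> G (max m n)"
        using mono[of m "max m n"] mono[of n "max m n"] by auto
      then show ?case ..
    qed simp
    then show ?thesis using ded that by blast
  qed
  have "henkin_set Th"
  proof
    fix B C assume wff: "wff B" "wff C"
    show "(B \<^bold>\<longrightarrow> C) \<in> Th \<longleftrightarrow> (B \<in> Th \<longrightarrow> C \<in> Th)"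
    proof (intro iffI HOL.impI)
      assume "(B \<^bold>\<longrightarrow> C) \<in> Th" "B \<in> Th"
      then show "C \<in> Th"
        using wff by (intro closed[of "{B \<^bold>\<longrightarrow> C, B}"]) (auto intro: derives.impE derives.hyp)
    next
      assume imp: "B \<in> Th \<longrightarrow> C \<in> Th"
      show "(B \<^bold>\<longrightarrow> C) \<in> Th"
      proof (cases "C \<in> Th")
        case True
        then show ?thesis
          using wff by (intro closed[of "{C}"]) (auto intro: derives.impI derives.hyp)
      next
        case False
        then have "Neg B \<in> Th" using imp neg wff by blast
        moreover have "?T; insert (Neg C) {B, Neg B} \<turnstile> Bot"
          by (rule derives.impE[of _ _ B]; rule derives.hyp) (auto simp: Neg_def)
        then have "?T; {Neg B} \<turnstile> B \<^bold>\<longrightarrow> C"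
          using wff derives.impI derives.raa by blast
        ultimately show ?thesis using wff by (intro closed[of "{Neg B}"]) auto
      qed
    qed
  next
    show "Bot \<notin> Th" using P(2) derives.hyp by (fastforce simp: Th_def)
  next
    fix B \<rho> assume wff: "wff B"
    show "All \<rho> B \<in> Th \<longleftrightarrow> (\<forall>t. t \<Colon> \<rho> \<longrightarrow> inst_fm \<rho> t B \<in> Th)"
    proof (intro iffI HOL.allI HOL.impI)
      fix t assume "All \<rho> B \<in> Th" "t \<Colon> \<rho>"
      then show "inst_fm \<rho> t B \<in> Th"
        using wff by (intro closed[of "{All \<rho> B}"])
          (auto intro: derives.allE derives.hyp simp: subst_wff wt_subst_inst)
    next
      assume all: "\<forall>t. t \<Colon> \<rho> \<longrightarrow> inst_fm \<rho> t B \<in> Th"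
      show "All \<rho> B \<in> Th"
      proof (rule ccontr)
        assume "All \<rho> B \<notin> Th"
        then obtain i where "Neg (inst_fm \<rho> (Var \<rho> i) B) \<in> Th"
          using spec[OF PQ, of "to_nat (All \<rho> B)"] wff by (auto simp: Q_def Th_def)
        then show False
          using neg all wff by (simp add: subst_wff wt_subst_inst)
      qed
    qed
  next
    fix B assume "B \<in> ?T"
    then show "B \<in> Th" by (intro closed[of "{}"]) (auto intro: derives.axiom simp: RCA0_omega_wff)
  qed
  moreover have "A \<in> Th" using P by (auto simp: Th_def)
  ultimately show ?thesis by blast
qed

section \<open>Extensional structures\<close>

lemma push_numeral [simp]:
  "push \<rho> x e \<rho> 1 = e \<rho> 0"
  "push \<rho> x e \<rho> (numeral k) = e \<rho> (pred_numeral k)"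
  by (simp_all add: push_def numeral_eq_Suc)

lemma push_swap: "\<rho> \<noteq> \<sigma> \<Longrightarrow> push \<rho> x (push \<sigma> y e) = push \<sigma> y (push \<rho> x e)"
  by (auto simp: fun_eq_iff push_def split: nat.split)

lemma ty_of_subst [simp]: "wt_subst \<theta> \<Longrightarrow> ty_of (subst_tm \<theta> t) = ty_of t"
  by (induction t) (auto simp: wt_subst_def has_ty_def)

lemma wt_subst_tm [simp]: "wt_subst \<theta> \<Longrightarrow> wt (subst_tm \<theta> t) = wt t"
  by (induction t) (auto simp: wt_subst_def has_ty_def)

lemma ty_of_lam [simp]: "ty_of (lam \<rho> t) = (\<rho> \<rightarrow>\<^sub>t ty_of t)"
  by (induction t) (auto simp: K_def split: nat.split)

lemma wt_lam [simp]: "wt (lam \<rho> t) = wt t"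
  by (induction t) (auto simp: K_def split: nat.split intro: sym)

lemma inst_0 [simp]: "inst \<rho> t \<rho> 0 = t"
  by (simp add: inst_def)

declare lam.simps [simp del]

text \<open>All finite types share one carrier and \<open>D\<close> selects the elements of each,
  since HOL has no family of types indexed by \<open>ty\<close>. The elements of a function type
  need not exhaust all functions; \<open>ap_ext\<close> only demands that they are determined by
  their values.\<close>

locale ext_structure =
  fixes D :: "ty \<Rightarrow> 'a set" and ap :: "'a \<Rightarrow> 'a \<Rightarrow> 'a" (infixl "\<bullet>" 100) and I :: "tm \<Rightarrow> 'a"
  assumes D_nonempty: "D \<rho> \<noteq> {}"
    and ap_in [intro]: "a \<in> D (\<rho> \<rightarrow>\<^sub>t \<tau>) \<Longrightarrow> x \<in> D \<rho> \<Longrightarrow> a \<bullet> x \<in> D \<tau>"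
    and I_in [simp, intro]: "I Zero \<in> D N" "I Succ \<in> D T1" "I (PiC \<rho> \<sigma>) \<in> D (ty_of (PiC \<rho> \<sigma>))"
      "I (SigmaC \<rho> \<sigma> \<tau>) \<in> D (ty_of (SigmaC \<rho> \<sigma> \<tau>))" "I Rec \<in> D (ty_of Rec)"
    and ap_ext: "a \<in> D (\<rho> \<rightarrow>\<^sub>t \<tau>) \<Longrightarrow> b \<in> D (\<rho> \<rightarrow>\<^sub>t \<tau>) \<Longrightarrow> (\<And>x. x \<in> D \<rho> \<Longrightarrow> a \<bullet> x = b \<bullet> x) \<Longrightarrow> a = b"
begin

definition env :: "(ty \<Rightarrow> nat \<Rightarrow> 'a) \<Rightarrow> bool" where
  "env e \<longleftrightarrow> (\<forall>\<tau> i. e \<tau> i \<in> D \<tau>)"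

primrec eval :: "(ty \<Rightarrow> nat \<Rightarrow> 'a) \<Rightarrow> tm \<Rightarrow> 'a" where
  "eval e (Var \<rho> i) = e \<rho> i"
| "eval e Zero = I Zero"
| "eval e Succ = I Succ"
| "eval e (PiC \<rho> \<sigma>) = I (PiC \<rho> \<sigma>)"
| "eval e (SigmaC \<rho> \<sigma> \<tau>) = I (SigmaC \<rho> \<sigma> \<tau>)"
| "eval e Rec = I Rec"
| "eval e (s \<cdot> t) = eval e s \<bullet> eval e t"

primrec sat :: "(ty \<Rightarrow> nat \<Rightarrow> 'a) \<Rightarrow> fm \<Rightarrow> bool" where
  "sat e (s \<approx> t) \<longleftrightarrow> eval e s = eval e t"
| "sat e Bot \<longleftrightarrow> False"
| "sat e (A \<^bold>\<longrightarrow> B) \<longleftrightarrow> (sat e A \<longrightarrow> sat e B)"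
| "sat e (All \<rho> A) \<longleftrightarrow> (\<forall>x\<in>D \<rho>. sat (push \<rho> x e) A)"

lemma sat_defs [simp]:
  "sat e (Neg A) \<longleftrightarrow> \<not> sat e A"
  "sat e (A \<^bold>\<or> B) \<longleftrightarrow> sat e A \<or> sat e B"
  "sat e (A \<^bold>\<and> B) \<longleftrightarrow> sat e A \<and> sat e B"
  "sat e (Ex \<rho> A) \<longleftrightarrow> (\<exists>x\<in>D \<rho>. sat (push \<rho> x e) A)"
  by (auto simp: Neg_def Dis_def Con_def Ex_def)

lemma env_in [simp]: "env e \<Longrightarrow> e \<tau> i \<in> D \<tau>"
  by (simp add: env_def)

lemma env_push [simp]: "env e \<Longrightarrow> x \<in> D \<rho> \<Longrightarrow> env (push \<rho> x e)"
  by (auto simp: env_def push_def split: nat.split)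

lemma eval_in: "wt t \<Longrightarrow> env e \<Longrightarrow> eval e t \<in> D (ty_of t)"
proof (induction t)
  case (App s t)
  then obtain \<tau> where "ty_of s = (ty_of t \<rightarrow>\<^sub>t \<tau>)" by auto
  then show ?case using App by (auto intro: ap_in)
qed (use I_in in \<open>auto simp del: ty_of.simps(4,5,6)\<close>)

lemma eval_in': "wt t \<Longrightarrow> env e \<Longrightarrow> ty_of t = \<tau> \<Longrightarrow> eval e t \<in> D \<tau>"
  using eval_in by blast

lemma eval_subst: "eval e (subst_tm \<theta> t) = eval (\<lambda>\<tau> i. eval e (\<theta> \<tau> i)) t"
  by (induction t) auto

lemma eval_lift [simp]: "eval (push \<rho> x e) (lift_tm \<rho> t) = eval e t"
proof -
  have "(\<lambda>\<tau> i. eval (push \<rho> x e) (shift \<rho> \<tau> i)) = e"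
    by (auto simp: fun_eq_iff shift_def push_def)
  then show ?thesis by (simp add: eval_subst)
qed

lemma sat_subst: "sat e (subst_fm \<theta> A) = sat (\<lambda>\<tau> i. eval e (\<theta> \<tau> i)) A"
proof (induction A arbitrary: e \<theta>)
  case (All \<rho> A)
  have "(\<lambda>\<tau> i. eval (push \<rho> x e) (under \<rho> \<theta> \<tau> i)) = push \<rho> x (\<lambda>\<tau> i. eval e (\<theta> \<tau> i))" for x
    by (auto simp: fun_eq_iff push_def[of _ _ "\<lambda>\<tau> i. eval e (\<theta> \<tau> i)"] under_def split: nat.split)
  then show ?case using All by simp
qed (auto simp: eval_subst)

lemma sat_lift [simp]: "sat (push \<rho> x e) (lift_fm \<rho> A) = sat e A"
proof -
  have "(\<lambda>\<tau> i. eval (push \<rho> x e) (shift \<rho> \<tau> i)) = e"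
    by (auto simp: fun_eq_iff shift_def push_def)
  then show ?thesis by (simp add: sat_subst)
qed

lemma sat_inst: "sat e (inst_fm \<rho> t A) = sat (push \<rho> (eval e t) e) A"
proof -
  have "(\<lambda>\<tau> i. eval e (inst \<rho> t \<tau> i)) = push \<rho> (eval e t) e"
    by (auto simp: fun_eq_iff inst_def push_def split: nat.split)
  then show ?thesis by (simp add: sat_subst)
qed

text \<open>Extensionality of the structure turns the defined equality of higher type into plain
  equality of elements, by recursion on the type.\<close>

lemma sat_eq_at:
  "s \<Colon> \<rho> \<Longrightarrow> t \<Colon> \<rho> \<Longrightarrow> env e \<Longrightarrow> sat e (eq_at \<rho> s t) \<longleftrightarrow> eval e s = eval e t"
proof (induction \<rho> arbitrary: s t e)
  case (Fn \<rho> \<tau>)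
  have "sat e (eq_at (\<rho> \<rightarrow>\<^sub>t \<tau>) s t) \<longleftrightarrow> (\<forall>x\<in>D \<rho>. eval e s \<bullet> x = eval e t \<bullet> x)"
    using Fn by (auto simp: has_ty_def)
  also have "\<dots> \<longleftrightarrow> eval e s = eval e t"
    using Fn.prems ap_ext[OF eval_in'[of s e] eval_in'[of t e]] by (auto simp: has_ty_def)
  finally show ?case .
qed simp

end

locale rca_model = ext_structure +
  assumes sat_axiom: "A \<in> RCA0_omega \<Longrightarrow> env e \<Longrightarrow> sat e A"

section \<open>Completeness\<close>

context henkin_set begin

definition eqv :: "ty \<Rightarrow> tm \<Rightarrow> tm \<Rightarrow> bool" where
  "eqv \<rho> s t \<longleftrightarrow> eq_at \<rho> s t \<in> Th"

lemma eqv_Fn: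
  assumes "s \<Colon> \<rho> \<rightarrow>\<^sub>t \<tau>" "t \<Colon> \<rho> \<rightarrow>\<^sub>t \<tau>"
  shows "eqv (\<rho> \<rightarrow>\<^sub>t \<tau>) s t \<longleftrightarrow> (\<forall>u. u \<Colon> \<rho> \<longrightarrow> eqv \<tau> (s \<cdot> u) (t \<cdot> u))"
proof -
  have "wff (eq_at (\<rho> \<rightarrow>\<^sub>t \<tau>) s t)" using assms by (rule wff_eq_at)
  then show ?thesis
    by (simp add: eqv_def All_iff subst_eq_at)
qed

lemma eqv_refl: "t \<Colon> \<rho> \<Longrightarrow> eqv \<rho> t t"
proof (induction \<rho> arbitrary: t)
  case N
  then show ?case by (simp add: eqv_def axioms RCA0_omega.eq_refl)
next
  case (Fn \<rho> \<tau>)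
  then show ?case by (auto simp: eqv_Fn intro: has_ty_AppI)
qed

lemma eqv_N_subst:
  assumes "eqv N s t" "s \<Colon> N" "t \<Colon> N" "wff A" "inst_fm N s A \<in> Th"
  shows "inst_fm N t A \<in> Th"
  using axioms[OF RCA0_omega.eq_subst[OF assms(2-4)]] assms
  by (simp add: Imp_iff subst_wff wt_subst_inst eqv_def)

text \<open>At type 0 the replacement axiom is applied to the formula x = s; higher types reduce to
  it through \<open>eqv_Fn\<close>.\<close>

lemma eqv_sym: "s \<Colon> \<rho> \<Longrightarrow> t \<Colon> \<rho> \<Longrightarrow> eqv \<rho> s t \<Longrightarrow> eqv \<rho> t s"
proof (induction \<rho> arbitrary: s t)
  case N
  then show ?case
    using eqv_N_subst[of s t "Var N 0 \<approx> lift_tm N s"] eqv_refl[of s N]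
    by (simp add: eqv_def subst_has_ty)
next
  case (Fn \<rho> \<tau>)
  from Fn.prems show ?case by (simp add: eqv_Fn) (blast intro: Fn.IH(2) has_ty_AppI)
qed

lemma eqv_trans: "s \<Colon> \<rho> \<Longrightarrow> t \<Colon> \<rho> \<Longrightarrow> u \<Colon> \<rho> \<Longrightarrow> eqv \<rho> s t \<Longrightarrow> eqv \<rho> t u \<Longrightarrow> eqv \<rho> s u"
proof (induction \<rho> arbitrary: s t u)
  case N
  then show ?case
    using eqv_N_subst[of t u "lift_tm N s \<approx> Var N 0"]
    by (simp add: eqv_def subst_has_ty)
next
  case (Fn \<rho> \<tau>)
  have "eqv \<tau> (s \<cdot> v) (u \<cdot> v)" if v: "v \<Colon> \<rho>" for v
    using Fn.IH(2)[of "s \<cdot> v" "t \<cdot> v" "u \<cdot> v"] Fn.prems v has_ty_AppI by (simp add: eqv_Fn)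
  with Fn.prems show ?case by (simp add: eqv_Fn)
qed

text \<open>Congruence in the function is built into equality of higher type; congruence in the
  argument is exactly the extensionality axiom.\<close>

lemma eqv_App:
  assumes "s \<Colon> \<rho> \<rightarrow>\<^sub>t \<tau>" "s' \<Colon> \<rho> \<rightarrow>\<^sub>t \<tau>" "t \<Colon> \<rho>" "t' \<Colon> \<rho>"
    and "eqv (\<rho> \<rightarrow>\<^sub>t \<tau>) s s'" "eqv \<rho> t t'"
  shows "eqv \<tau> (s \<cdot> t) (s' \<cdot> t')"
proof (rule eqv_trans[of _ _ "s' \<cdot> t"])
  show "eqv \<tau> (s \<cdot> t) (s' \<cdot> t)" using assms by (simp add: eqv_Fn)
  show "eqv \<tau> (s' \<cdot> t) (s' \<cdot> t')"
    using axioms[OF RCA0_omega.extensionality[OF assms(2-4)]] assms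
    by (simp add: eqv_def Imp_iff wff_eq_at has_ty_AppI)
qed (use assms in \<open>auto intro: has_ty_AppI\<close>)

text \<open>Choosing a representative of each class, instead of forming quotients, keeps the single
  carrier \<open>tm\<close>. The choice depends only on the class, since the predicate under
  \<open>SOME\<close> does (\<open>rep_eq_iff\<close>).\<close>

definition rep :: "tm \<Rightarrow> tm" where
  "rep t = (SOME s. s \<Colon> ty_of t \<and> eqv (ty_of t) s t)"

lemma rep:
  assumes "t \<Colon> \<rho>"
  shows "rep t \<Colon> \<rho>" "eqv \<rho> (rep t) t"
proof -
  have "rep t \<Colon> ty_of t \<and> eqv (ty_of t) (rep t) t"
    unfolding rep_def by (rule someI[of _ t]) (use assms eqv_refl in \<open>auto simp: has_ty_def\<close>)
  then show "rep t \<Colon> \<rho>" "eqv \<rho> (rep t) t" using assms by (auto simp: has_ty_def)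
qed

lemma rep_eq_iff:
  assumes "s \<Colon> \<rho>" "t \<Colon> \<rho>"
  shows "rep s = rep t \<longleftrightarrow> eqv \<rho> s t"
proof
  assume "rep s = rep t"
  then show "eqv \<rho> s t"
    using assms rep eqv_trans eqv_sym by metis
next
  assume st: "eqv \<rho> s t"
  have "u \<Colon> \<rho> \<and> eqv \<rho> u s \<longleftrightarrow> u \<Colon> \<rho> \<and> eqv \<rho> u t" for u
    using assms st eqv_trans eqv_sym by metis
  then show "rep s = rep t"
    using assms by (simp add: rep_def has_ty_def)
qed

lemma rep_rep: "t \<Colon> \<rho> \<Longrightarrow> rep (rep t) = rep t"
  using rep rep_eq_iff by metis

definition DT :: "ty \<Rightarrow> tm set" where
  "DT \<rho> = {rep t | t. t \<Colon> \<rho>}"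

lemma rep_in_DT: "t \<Colon> \<rho> \<Longrightarrow> rep t \<in> DT \<rho>"
  by (auto simp: DT_def)

lemma ball_DT: "(\<forall>x\<in>DT \<rho>. P x) \<longleftrightarrow> (\<forall>t. t \<Colon> \<rho> \<longrightarrow> P (rep t))"
  by (auto simp: DT_def)

lemma rep_App: "s \<Colon> \<rho> \<rightarrow>\<^sub>t \<tau> \<Longrightarrow> t \<Colon> \<rho> \<Longrightarrow> rep (rep s \<cdot> rep t) = rep (s \<cdot> t)"
  using rep_eq_iff[of "rep s \<cdot> rep t" \<tau> "s \<cdot> t"] eqv_App[of "rep s" \<rho> \<tau> s "rep t" t] rep has_ty_AppI
  by metis

sublocale term_model: ext_structure DT "\<lambda>s t. rep (s \<cdot> t)" rep
proof
  fix \<rho> \<tau> a b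
  show "DT \<rho> \<noteq> {}" using rep_in_DT[of "Var \<rho> 0" \<rho>] by auto
  show "rep (a \<cdot> x) \<in> DT \<tau>" if "a \<in> DT (\<rho> \<rightarrow>\<^sub>t \<tau>)" "x \<in> DT \<rho>" for x
  proof -
    from that have "a \<Colon> \<rho> \<rightarrow>\<^sub>t \<tau>" "x \<Colon> \<rho>" using rep(1) by (auto simp: DT_def)
    then show ?thesis using rep_in_DT has_ty_AppI by blast
  qed
  assume ab: "a \<in> DT (\<rho> \<rightarrow>\<^sub>t \<tau>)" "b \<in> DT (\<rho> \<rightarrow>\<^sub>t \<tau>)"
    and eq: "\<And>x. x \<in> DT \<rho> \<Longrightarrow> rep (a \<cdot> x) = rep (b \<cdot> x)"
  then obtain s t where st: "a = rep s" "b = rep t" "s \<Colon> \<rho> \<rightarrow>\<^sub>t \<tau>" "t \<Colon> \<rho> \<rightarrow>\<^sub>t \<tau>"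
    by (auto simp: DT_def)
  have "eqv \<tau> (s \<cdot> u) (t \<cdot> u)" if u: "u \<Colon> \<rho>" for u
  proof -
    have "rep (s \<cdot> u) = rep (t \<cdot> u)"
      using eq[OF rep_in_DT[OF u]] by (simp only: st(1,2) rep_App[OF st(3) u] rep_App[OF st(4) u])
    then show ?thesis
      using rep_eq_iff[OF has_ty_AppI[OF st(3) u] has_ty_AppI[OF st(4) u]] by simp
  qed
  then have "eqv (\<rho> \<rightarrow>\<^sub>t \<tau>) s t" by (simp add: eqv_Fn[OF st(3,4)])
  then show "a = b" using rep_eq_iff[OF st(3,4)] st(1,2) by simp
qed (rule rep_in_DT; simp)+

lemma eval_term_model: "wt t \<Longrightarrow> wt_subst \<theta> \<Longrightarrow> term_model.eval (\<lambda>\<tau> i. rep (\<theta> \<tau> i)) t = rep (subst_tm \<theta> t)"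
proof (induction t)
  case (App s t)
  then obtain \<tau> where "ty_of s = (ty_of t \<rightarrow>\<^sub>t \<tau>)" by auto
  with App show ?case
    by (auto intro!: rep_App[of _ "ty_of t" \<tau>] simp: has_ty_def)
qed auto

text \<open>The truth lemma. It is proved for all substitutions at once, because the quantifier case
  extends \<open>\<theta>\<close> by the instantiating term.\<close>

lemma sat_term_model:
  "wff A \<Longrightarrow> wt_subst \<theta> \<Longrightarrow> term_model.sat (\<lambda>\<tau> i. rep (\<theta> \<tau> i)) A \<longleftrightarrow> subst_fm \<theta> A \<in> Th"
proof (induction A arbitrary: \<theta>)
  case (Eq s t)
  then show ?case
    using rep_eq_iff[of "subst_tm \<theta> s" N "subst_tm \<theta> t"]
    by (simp add: eval_term_model subst_has_ty) (simp add: has_ty_def eval_term_model eqv_def)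
next
  case (All \<rho> A)
  have push: "(\<lambda>\<tau> i. rep (push \<rho> t \<theta> \<tau> i)) = push \<rho> (rep t) (\<lambda>\<tau> i. rep (\<theta> \<tau> i))" for t
    by (auto simp: fun_eq_iff push_def split: nat.split)
  have "term_model.sat (push \<rho> (rep t) (\<lambda>\<tau> i. rep (\<theta> \<tau> i))) A \<longleftrightarrow> subst_fm (push \<rho> t \<theta>) A \<in> Th"
    if "t \<Colon> \<rho>" for t
    using All.IH[of "push \<rho> t \<theta>"] All.prems that by (simp add: wt_subst_push push)
  then show ?case
    using All.prems by (auto simp: All_iff subst_wff wt_subst_under inst_under_push ball_DT)
qed (auto simp: Bot_notin Imp_iff subst_wff)

sublocale term_model: rca_model DT "\<lambda>s t. rep (s \<cdot> t)" rep
proof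
  fix A e
  assume A: "A \<in> RCA0_omega" and e: "term_model.env e"
  \<comment> \<open>An environment of the term model assigns representatives, which are well-typed
    terms, so it is itself a substitution and is fixed by \<open>rep\<close>.\<close>
  have wt: "wt_subst e" and "(\<lambda>\<tau> i. rep (e \<tau> i)) = e"
    using e by (auto simp: term_model.env_def wt_subst_def DT_def fun_eq_iff) (metis rep rep_rep)+
  then show "term_model.sat e A"
    using sat_term_model[OF RCA0_omega_wff[OF A] wt] axioms[OF RCA0_omega_subst[OF A wt]] by simp
qed

end

text \<open>HOL cannot quantify over carrier types inside an assumption. Validity is therefore
  required on the carrier \<open>tm\<close> only, which is where the term model lives.\<close>

theorem completeness:
  assumes "wff A"
    and sat: "\<And>(D :: ty \<Rightarrow> tm set) ap I e. rca_model D ap I \<Longrightarrow> ext_structure.env D e \<Longrightarrow>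
      ext_structure.sat D ap I e A"
  shows "RCA0_omega \<turnstile> A"
proof (rule ccontr)
  assume "\<not> RCA0_omega \<turnstile> A"
  then have "\<not> RCA0_omega; {Neg A} \<turnstile> Bot"
    using derives.raa[OF assms(1), of RCA0_omega "{}"] by (auto simp: proves_def)
  then obtain Th where "henkin_set Th" and A: "Neg A \<in> Th"
    using henkin_set_exists[of "Neg A"] assms(1) by auto
  then interpret henkin_set Th by simp
  have "term_model.sat (\<lambda>\<tau> i. rep (Var \<tau> i)) A"
    by (rule sat[OF term_model.rca_model_axioms]) (simp add: term_model.env_def rep_in_DT)
  then have "A \<in> Th" using sat_term_model[of A Var] assms(1) by simp
  then show False using A Imp_iff[of A Bot] assms(1) Bot_notin by (simp add: Neg_def)
qed

section \<open>Arithmetic in a model\<close>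

declare subst_tm.simps [simp del]

lemma wt_ops [simp]:
  "wt (add_tm s t) \<longleftrightarrow> s \<Colon> N \<and> t \<Colon> N"
  "wt (pred_tm t) \<longleftrightarrow> t \<Colon> N"
  "wt (monus_tm s t) \<longleftrightarrow> s \<Colon> N \<and> t \<Colon> N"
  "wt (max_tm s t) \<longleftrightarrow> s \<Colon> N \<and> t \<Colon> N"
  "wt (cosg t) \<longleftrightarrow> t \<Colon> N"
  "ty_of (add_tm s t) = N" "ty_of (pred_tm t) = N" "ty_of (monus_tm s t) = N"
  "ty_of (max_tm s t) = N" "ty_of (cosg t) = N"
  by (auto simp: add_tm_def pred_tm_def monus_tm_def max_tm_def cosg_def has_ty_def)

lemma wt_more_ops [simp]:
  "t \<Colon> N \<Longrightarrow> wt (sg t)" "ty_of (sg t) = N"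
  "f \<Colon> T1 \<Longrightarrow> l \<Colon> N \<Longrightarrow> wt (sum_upto f l)" "ty_of (sum_upto f l) = N"
  "X \<Colon> T1 \<Longrightarrow> Y \<Colon> T1 \<Longrightarrow> wt (inter_set X Y)" "ty_of (inter_set X Y) = T1"
  "X \<Colon> T1 \<Longrightarrow> wt (compl_set X)" "ty_of (compl_set X) = T1"
  "X \<Colon> T1 \<Longrightarrow> n \<Colon> N \<Longrightarrow> wt (translate X n)" "X \<Colon> T1 \<Longrightarrow> ty_of (translate X n) = T1"
  "X \<Colon> T1 \<Longrightarrow> wt (norm_set X)" "ty_of (norm_set X) = T1"
  "V \<Colon> T2 \<Longrightarrow> X \<Colon> T1 \<Longrightarrow> wt (idem_set V X)" "V \<Colon> T2 \<Longrightarrow> ty_of (idem_set V X) = T1"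
  by (auto simp: sg_def sum_upto_def inter_set_def compl_set_def translate_def norm_set_def
      idem_set_def has_ty_def)

lemma wff_less [simp]: "wff (s \<prec> t) \<longleftrightarrow> s \<Colon> N \<and> t \<Colon> N"
  by (auto simp: less_fm_def has_ty_def)

lemma qfree_simps [simp]:
  "qfree (s \<prec> t)" "qfree (Neg A) = qfree A" "qfree (A \<^bold>\<or> B) = (qfree A \<and> qfree B)"
  "qfree (A \<^bold>\<and> B) = (qfree A \<and> qfree B)"
  by (auto simp: less_fm_def Neg_def Dis_def Con_def)

context rca_model begin

abbreviation zero ("\<zero>") where "\<zero> \<equiv> I Zero"
abbreviation suc :: "'a \<Rightarrow> 'a" where "suc n \<equiv> I Succ \<bullet> n"
abbreviation Nat :: "'a set" ("\<N>") where "\<N> \<equiv> D N"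

lemmas ap_in_simps [simp] = ap_in[of _ N N] ap_in[of _ T1 N] ap_in[of _ N T1]

definition env0 :: "ty \<Rightarrow> nat \<Rightarrow> 'a" where
  "env0 \<tau> i = (SOME x. x \<in> D \<tau>)"

lemma env0 [simp]: "env env0"
  using D_nonempty by (auto simp: env_def env0_def some_in_eq)

lemma Pi_ap [simp]:
  assumes "x \<in> D \<rho>" "y \<in> D \<sigma>"
  shows "I (PiC \<rho> \<sigma>) \<bullet> x \<bullet> y = x"
proof -
  \<comment> \<open>The indices 0 and 1 keep the two variables apart when \<open>\<rho>\<close> and
    \<open>\<sigma>\<close> coincide.\<close>
  define e where "e = (env0 (\<rho> := (env0 \<rho>)(0 := x)))"
  define e' where "e' = e(\<sigma> := (e \<sigma>)(1 := y))"
  have "env e'" using assms env0 by (auto simp: env_def e'_def e_def)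
  moreover have "e' \<rho> 0 = x" "e' \<sigma> 1 = y" by (auto simp: e'_def e_def)
  ultimately show ?thesis
    using sat_axiom[OF RCA0_omega.Pi_eq[of "Var \<rho> 0" \<rho> "Var \<sigma> 1" \<sigma>]]
    by (auto simp: sat_eq_at has_ty_def)
qed

lemma Sigma_ap [simp]:
  assumes "x \<in> D (\<rho> \<rightarrow>\<^sub>t \<sigma> \<rightarrow>\<^sub>t \<tau>)" "y \<in> D (\<rho> \<rightarrow>\<^sub>t \<sigma>)" "z \<in> D \<rho>"
  shows "I (SigmaC \<rho> \<sigma> \<tau>) \<bullet> x \<bullet> y \<bullet> z = x \<bullet> z \<bullet> (y \<bullet> z)"
proof -
  define e where "e = (\<lambda>\<upsilon> i. if i = 0 \<and> \<upsilon> = (\<rho> \<rightarrow>\<^sub>t \<sigma> \<rightarrow>\<^sub>t \<tau>) then x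
    else if i = 1 \<and> \<upsilon> = (\<rho> \<rightarrow>\<^sub>t \<sigma>) then y else if i = 2 \<and> \<upsilon> = \<rho> then z else env0 \<upsilon> i)"
  have "env e" using assms env0 by (simp add: env_def e_def)
  then show ?thesis
    using sat_axiom[OF RCA0_omega.Sigma_eq[of "Var (\<rho> \<rightarrow>\<^sub>t \<sigma> \<rightarrow>\<^sub>t \<tau>) 0" \<rho> \<sigma> \<tau> "Var (\<rho> \<rightarrow>\<^sub>t \<sigma>) 1" "Var \<rho> 2"], of e]
    by (simp add: sat_eq_at has_ty_def) (simp add: e_def)
qed

text \<open>The beta rule of combinatory abstraction: \<open>Sigma_ap\<close> handles applications,
  \<open>Pi_ap\<close> handles terms without the bound variable, and the variable itself becomes the
  identity SKK.\<close>

lemma eval_lam [simp]: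
  "wt t \<Longrightarrow> env e \<Longrightarrow> x \<in> D \<rho> \<Longrightarrow> eval e (lam \<rho> t) \<bullet> x = eval (push \<rho> x e) t"
proof (induction t)
  case (App s t)
  then obtain \<tau> where \<tau>: "ty_of s = (ty_of t \<rightarrow>\<^sub>t \<tau>)" by auto
  have "eval e (lam \<rho> s) \<in> D (\<rho> \<rightarrow>\<^sub>t ty_of t \<rightarrow>\<^sub>t \<tau>)" "eval e (lam \<rho> t) \<in> D (\<rho> \<rightarrow>\<^sub>t ty_of t)"
    using App.prems \<tau> by (auto intro!: eval_in')
  with App \<tau> show ?case by (simp add: lam.simps)
next
  case (Var \<tau> i)
  have Pi: "I (PiC \<rho> \<sigma>) \<in> D (\<rho> \<rightarrow>\<^sub>t \<sigma> \<rightarrow>\<^sub>t \<rho>)" for \<rho> \<sigma> using I_in(3) by simp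
  show ?case
  proof (cases "\<tau> = \<rho> \<and> i = 0")
    case True
    then show ?thesis
      using Var Sigma_ap[OF Pi[of \<rho> "\<rho> \<rightarrow>\<^sub>t \<rho>"] Pi[of \<rho> \<rho>]] Pi[of \<rho> \<rho>] by (simp add: lam.simps ap_in)
  next
    case False
    then show ?thesis using Var by (auto simp: lam.simps K_def split: nat.split)
  qed
qed (use I_in in \<open>auto simp: lam.simps K_def\<close>)

definition rec :: "'a \<Rightarrow> 'a \<Rightarrow> 'a \<Rightarrow> 'a" where
  "rec n y f = I Rec \<bullet> n \<bullet> y \<bullet> f"

lemma rec_in [simp, intro]:
  "n \<in> \<N> \<Longrightarrow> y \<in> \<N> \<Longrightarrow> f \<in> D (N \<rightarrow>\<^sub>t N \<rightarrow>\<^sub>t N) \<Longrightarrow> rec n y f \<in> \<N>"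
  using I_in(5) by (auto simp: rec_def)

lemma rec_zero [simp]:
  assumes "y \<in> \<N>" "f \<in> D (N \<rightarrow>\<^sub>t N \<rightarrow>\<^sub>t N)"
  shows "rec \<zero> y f = y"
  using sat_axiom[OF RCA0_omega.Rec_zero[of "Var N 0" "Var (N \<rightarrow>\<^sub>t N \<rightarrow>\<^sub>t N) 0"],
      of "push N y (push (N \<rightarrow>\<^sub>t N \<rightarrow>\<^sub>t N) f env0)"] assms
  by (simp add: rec_def)

lemma rec_suc [simp]:
  assumes "n \<in> \<N>" "y \<in> \<N>" "f \<in> D (N \<rightarrow>\<^sub>t N \<rightarrow>\<^sub>t N)"
  shows "rec (suc n) y f = f \<bullet> rec n y f \<bullet> n"
  using sat_axiom[OF RCA0_omega.Rec_succ[of "Var N 0" "Var N 1" "Var (N \<rightarrow>\<^sub>t N \<rightarrow>\<^sub>t N) 0"],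
      of "push N n (push N y (push (N \<rightarrow>\<^sub>t N \<rightarrow>\<^sub>t N) f env0))"] assms
  by (simp add: rec_def)

lemma suc_neq_zero [simp]: "n \<in> \<N> \<Longrightarrow> suc n \<noteq> \<zero>"
  using sat_axiom[OF RCA0_omega.succ_nonzero[of "Var N 0"], of "push N n env0"] by simp

lemma suc_inject [simp]: "m \<in> \<N> \<Longrightarrow> n \<in> \<N> \<Longrightarrow> suc m = suc n \<longleftrightarrow> m = n"
  using sat_axiom[OF RCA0_omega.succ_inj[of "Var N 0" "Var N 1"], of "push N m (push N n env0)"]
  by auto

text \<open>\<open>P\<close> is an arbitrary HOL predicate, and the premise \<open>sat\<close>
  certifies that it is definable. In \<open>B\<close> the induction variable is
  \<open>Var N 1\<close> and the existential witness is \<open>Var N 0\<close>; all other variables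
  are parameters from \<open>e\<close>.\<close>

lemma Sigma01_induct [consumes 4, case_names sat zero suc]:
  assumes "env e" "wff B" "qfree B" "n \<in> \<N>"
    and sat: "\<And>n. n \<in> \<N> \<Longrightarrow> P n \<longleftrightarrow> (\<exists>m\<in>\<N>. sat (push N m (push N n e)) B)"
    and zero: "P \<zero>" and suc: "\<And>n. n \<in> \<N> \<Longrightarrow> P n \<Longrightarrow> P (suc n)"
  shows "P n"
proof -
  have succ: "sat (push N k e) (succ_fm A) = sat (push N (suc k) e) A" for k A
  proof -
    have "(\<lambda>\<tau> i. eval (push N k e) (if \<tau> = N \<and> i = 0 then Succ \<cdot> Var N 0 else Var \<tau> i)) = push N (suc k) e"
      by (auto simp: fun_eq_iff push_def split: nat.split)
    then show ?thesis by (simp add: succ_fm_def sat_subst)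
  qed
  show ?thesis
    using sat_axiom[OF RCA0_omega.Sigma01_induction[OF assms(2,3) refl] assms(1)]
      assms(4) zero suc unfolding sat.simps sat_inst succ eval.simps sat_defs
    by (metis (no_types, lifting) sat I_in(1) ap_in_simps(1) I_in(2))
qed

text \<open>A quantifier-free formula becomes Sigma01 by a dummy quantifier, hence the lifted
  \<open>B\<close>.\<close>

lemma qf_induct [consumes 4, case_names sat zero suc]:
  assumes "env e" "wff B" "qfree B" "n \<in> \<N>"
    and sat: "\<And>n. n \<in> \<N> \<Longrightarrow> P n \<longleftrightarrow> sat (push N n e) B"
    and zero: "P \<zero>" and suc: "\<And>n. n \<in> \<N> \<Longrightarrow> P n \<Longrightarrow> P (suc n)"
  shows "P n"
  by (rule Sigma01_induct[where B = "lift_fm N B" and e = e])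
    (use assms in \<open>auto simp: subst_wff subst_qfree\<close>)

lemma QF_AC:
  assumes "env e" "wff A" "qfree A" "\<And>f. f \<in> D T1 \<Longrightarrow> \<exists>x\<in>\<N>. sat (push N x (push T1 f e)) A"
  shows "\<exists>F\<in>D T2. \<forall>f\<in>D T1. sat (push N (F \<bullet> f) (push T1 f e)) A"
proof -
  \<comment> \<open>The variable for \<open>F\<close> lies outside in the axiom but not in the
    lifted matrix; since the types differ, \<open>push_swap\<close> moves it to where the lift
    cancels it.\<close>
  have "sat (push N (F \<bullet> f) (push T1 f (push T2 F e))) (lift_fm T2 A) = sat (push N (F \<bullet> f) (push T1 f e)) A" for F f
  proof -
    have "push N (F \<bullet> f) (push T1 f (push T2 F e)) = push T2 F (push N (F \<bullet> f) (push T1 f e))"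
      by (simp add: push_swap[of _ T2])
    then show ?thesis by simp
  qed
  then show ?thesis
    using sat_axiom[OF RCA0_omega.QF_AC_1_0[OF assms(2,3)] assms(1)] assms(4)
    by (simp add: sat_inst)
qed

text \<open>The predecessor is the witness of a Sigma01 formula, so the case distinction is itself
  an induction.\<close>

lemma nat_cases:
  assumes "n \<in> \<N>"
  obtains "n = \<zero>" | m where "m \<in> \<N>" "n = suc m"
proof -
  have "n = \<zero> \<or> (\<exists>m\<in>\<N>. n = suc m)"
    by (rule Sigma01_induct[where P = "\<lambda>n. n = \<zero> \<or> (\<exists>m\<in>\<N>. n = suc m)" and e = env0 and
          B = "(Var N 1 \<approx> Zero) \<^bold>\<or> (Var N 1 \<approx> Succ \<cdot> Var N 0)"])
      (use assms in \<open>auto simp: has_ty_def Dis_def Neg_def\<close>)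
  then show ?thesis using that by blast
qed

text \<open>The step functions are closed terms, so their values do not depend on the environment.\<close>

definition pl :: "'a \<Rightarrow> 'a \<Rightarrow> 'a" (infixl "\<oplus>" 65) where
  "a \<oplus> b = rec b a (eval env0 (lam N (lam N (Succ \<cdot> Var N 1))))"

definition pr :: "'a \<Rightarrow> 'a" where
  "pr a = rec a \<zero> (eval env0 (lam N (lam N (Var N 0))))"

definition mo :: "'a \<Rightarrow> 'a \<Rightarrow> 'a" (infixl "\<ominus>" 65) where
  "a \<ominus> b = rec b a (eval env0 (lam N (lam N (pred_tm (Var N 1)))))"

definition csg :: "'a \<Rightarrow> 'a" where
  "csg a = rec a (suc \<zero>) (eval env0 (lam N (lam N Zero)))"

definition mx :: "'a \<Rightarrow> 'a \<Rightarrow> 'a" where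
  "mx a b = a \<oplus> (b \<ominus> a)"

definition lt :: "'a \<Rightarrow> 'a \<Rightarrow> bool" (infix "\<lhd>" 50) where
  "a \<lhd> b \<longleftrightarrow> suc a \<ominus> b = \<zero>"

lemma eval_ops [simp]:
  "eval e (add_tm s t) = eval e s \<oplus> eval e t"
  "eval e (pred_tm t) = pr (eval e t)"
  "eval e (monus_tm s t) = eval e s \<ominus> eval e t"
  "eval e (max_tm s t) = mx (eval e s) (eval e t)"
  "eval e (cosg t) = csg (eval e t)"
  by (simp_all add: lam.simps add_tm_def pl_def rec_def K_def pred_tm_def pr_def monus_tm_def mo_def
      max_tm_def mx_def cosg_def csg_def)

lemma sat_less [simp]: "sat e (s \<prec> t) \<longleftrightarrow> eval e s \<lhd> eval e t"
  by (simp add: less_fm_def lt_def)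

lemma pl_zero [simp]: "a \<in> \<N> \<Longrightarrow> a \<oplus> \<zero> = a"
  and pl_suc [simp]: "a \<in> \<N> \<Longrightarrow> b \<in> \<N> \<Longrightarrow> a \<oplus> suc b = suc (a \<oplus> b)"
  and pl_in [simp, intro]: "a \<in> \<N> \<Longrightarrow> b \<in> \<N> \<Longrightarrow> a \<oplus> b \<in> \<N>"
proof -
  have "eval env0 (lam N (lam N (Succ \<cdot> Var N 1))) \<in> D (N \<rightarrow>\<^sub>t N \<rightarrow>\<^sub>t N)"
    by (rule eval_in') auto
  then show "a \<in> \<N> \<Longrightarrow> a \<oplus> \<zero> = a" "a \<in> \<N> \<Longrightarrow> b \<in> \<N> \<Longrightarrow> a \<oplus> b \<in> \<N>"
    "a \<in> \<N> \<Longrightarrow> b \<in> \<N> \<Longrightarrow> a \<oplus> suc b = suc (a \<oplus> b)"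
    by (simp_all add: pl_def rec_in)
qed

lemma pr_zero [simp]: "pr \<zero> = \<zero>"
  and pr_suc [simp]: "a \<in> \<N> \<Longrightarrow> pr (suc a) = a"
  and pr_in [simp, intro]: "a \<in> \<N> \<Longrightarrow> pr a \<in> \<N>"
proof -
  have "eval env0 (lam N (lam N (Var N 0))) \<in> D (N \<rightarrow>\<^sub>t N \<rightarrow>\<^sub>t N)"
    by (rule eval_in') auto
  then show "pr \<zero> = \<zero>" "a \<in> \<N> \<Longrightarrow> pr a \<in> \<N>" "a \<in> \<N> \<Longrightarrow> pr (suc a) = a"
    by (simp_all add: pr_def rec_in)
qed

lemma mo_zero [simp]: "a \<in> \<N> \<Longrightarrow> a \<ominus> \<zero> = a"
  and mo_suc [simp]: "a \<in> \<N> \<Longrightarrow> b \<in> \<N> \<Longrightarrow> a \<ominus> suc b = pr (a \<ominus> b)"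
  and mo_in [simp, intro]: "a \<in> \<N> \<Longrightarrow> b \<in> \<N> \<Longrightarrow> a \<ominus> b \<in> \<N>"
proof -
  have "eval env0 (lam N (lam N (pred_tm (Var N 1)))) \<in> D (N \<rightarrow>\<^sub>t N \<rightarrow>\<^sub>t N)"
    by (rule eval_in') auto
  then show "a \<in> \<N> \<Longrightarrow> a \<ominus> \<zero> = a" "a \<in> \<N> \<Longrightarrow> b \<in> \<N> \<Longrightarrow> a \<ominus> b \<in> \<N>"
    "a \<in> \<N> \<Longrightarrow> b \<in> \<N> \<Longrightarrow> a \<ominus> suc b = pr (a \<ominus> b)"
    by (simp_all add: mo_def rec_in)
qed

lemma csg_zero [simp]: "csg \<zero> = suc \<zero>"
  and csg_suc [simp]: "a \<in> \<N> \<Longrightarrow> csg (suc a) = \<zero>"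
  and csg_in [simp, intro]: "a \<in> \<N> \<Longrightarrow> csg a \<in> \<N>"
proof -
  have "eval env0 (lam N (lam N Zero)) \<in> D (N \<rightarrow>\<^sub>t N \<rightarrow>\<^sub>t N)"
    by (rule eval_in') auto
  then show "csg \<zero> = suc \<zero>" "a \<in> \<N> \<Longrightarrow> csg a \<in> \<N>" "a \<in> \<N> \<Longrightarrow> csg (suc a) = \<zero>"
    by (simp_all add: csg_def rec_in)
qed

section \<open>Laws of addition and cut-off subtraction\<close>

lemma zero_pl [simp]: "a \<in> \<N> \<Longrightarrow> \<zero> \<oplus> a = a"
  by (rule qf_induct[where P = "\<lambda>a. \<zero> \<oplus> a = a" and e = env0 and B = "add_tm Zero (Var N 0) \<approx> Var N 0"])
    (auto simp: has_ty_def)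

lemma suc_pl [simp]: "a \<in> \<N> \<Longrightarrow> b \<in> \<N> \<Longrightarrow> suc a \<oplus> b = suc (a \<oplus> b)"
  by (rule qf_induct[where P = "\<lambda>b. suc a \<oplus> b = suc (a \<oplus> b)" and e = "push N a env0" and
      B = "add_tm (Succ \<cdot> Var N 1) (Var N 0) \<approx> Succ \<cdot> add_tm (Var N 1) (Var N 0)"])
    (auto simp: has_ty_def)

lemma pl_commute: "a \<in> \<N> \<Longrightarrow> b \<in> \<N> \<Longrightarrow> a \<oplus> b = b \<oplus> a"
  by (rule qf_induct[where P = "\<lambda>b. a \<oplus> b = b \<oplus> a" and e = "push N a env0" and
      B = "add_tm (Var N 1) (Var N 0) \<approx> add_tm (Var N 0) (Var N 1)"])
    (auto simp: has_ty_def)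

lemma pl_assoc: "a \<in> \<N> \<Longrightarrow> b \<in> \<N> \<Longrightarrow> c \<in> \<N> \<Longrightarrow> a \<oplus> b \<oplus> c = a \<oplus> (b \<oplus> c)"
  by (rule qf_induct[where P = "\<lambda>c. a \<oplus> b \<oplus> c = a \<oplus> (b \<oplus> c)" and e = "push N a (push N b env0)" and
      B = "add_tm (add_tm (Var N 1) (Var N 2)) (Var N 0) \<approx> add_tm (Var N 1) (add_tm (Var N 2) (Var N 0))"])
    (auto simp: has_ty_def)

lemma suc_mo_suc: "a \<in> \<N> \<Longrightarrow> b \<in> \<N> \<Longrightarrow> suc a \<ominus> suc b = a \<ominus> b"
  by (rule qf_induct[where P = "\<lambda>b. suc a \<ominus> suc b = a \<ominus> b" and e = "push N a env0" and
      B = "monus_tm (Succ \<cdot> Var N 1) (Succ \<cdot> Var N 0) \<approx> monus_tm (Var N 1) (Var N 0)"])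
    (auto simp: has_ty_def)

lemma pl_mo: "a \<in> \<N> \<Longrightarrow> b \<in> \<N> \<Longrightarrow> (b \<oplus> a) \<ominus> b = a"
  by (rule qf_induct[where P = "\<lambda>b. (b \<oplus> a) \<ominus> b = a" and e = "push N a env0" and
      B = "monus_tm (add_tm (Var N 0) (Var N 1)) (Var N 0) \<approx> Var N 1"])
    (auto simp: has_ty_def suc_mo_suc simp del: mo_suc)

lemma mo_pl: "a \<in> \<N> \<Longrightarrow> b \<in> \<N> \<Longrightarrow> a \<ominus> (a \<oplus> b) = \<zero>"
  by (rule qf_induct[where P = "\<lambda>b. a \<ominus> (a \<oplus> b) = \<zero>" and e = "push N a env0" and
      B = "monus_tm (Var N 1) (add_tm (Var N 1) (Var N 0)) \<approx> Zero"])
    (use pl_mo[of \<zero> a] in \<open>auto simp: has_ty_def\<close>)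

text \<open>The witness form suits calculation. Where a quantifier-free formula is required,
  \<open>mo_eq_zero_iff\<close> replaces it by an equation.\<close>

definition le :: "'a \<Rightarrow> 'a \<Rightarrow> bool" (infix "\<unlhd>" 50) where
  "a \<unlhd> b \<longleftrightarrow> (\<exists>c\<in>\<N>. b = a \<oplus> c)"

text \<open>Both alternatives share the witness c, so the disjunction has a single existential
  quantifier and induction on b applies.\<close>

lemma le_or_gt:
  assumes "a \<in> \<N>" "b \<in> \<N>"
  shows "\<exists>c\<in>\<N>. b = a \<oplus> c \<or> a = b \<oplus> suc c"
proof (rule Sigma01_induct[where P = "\<lambda>b. \<exists>c\<in>\<N>. b = a \<oplus> c \<or> a = b \<oplus> suc c" and e = "push N a env0" and
      B = "(Var N 1 \<approx> add_tm (Var N 2) (Var N 0)) \<^bold>\<or> (Var N 2 \<approx> add_tm (Var N 1) (Succ \<cdot> Var N 0))"])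
  show "\<exists>c\<in>\<N>. \<zero> = a \<oplus> c \<or> a = \<zero> \<oplus> suc c"
    using assms(1) by (rule nat_cases) (use assms in force)+
  fix b assume b: "b \<in> \<N>" "\<exists>c\<in>\<N>. b = a \<oplus> c \<or> a = b \<oplus> suc c"
  then obtain c where c: "c \<in> \<N>" "b = a \<oplus> c \<or> a = b \<oplus> suc c" by blast
  from c(2) show "\<exists>c\<in>\<N>. suc b = a \<oplus> c \<or> a = suc b \<oplus> suc c"
  proof
    assume "b = a \<oplus> c"
    then show ?thesis using assms c by (intro bexI[of _ "suc c"]) auto
  next
    assume a: "a = b \<oplus> suc c"
    from c(1) show ?thesis
    proof (rule nat_cases)
      assume "c = \<zero>"
      then show ?thesis using a b c by (intro bexI[of _ \<zero>]) auto
    next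
      fix d assume "d \<in> \<N>" "c = suc d"
      then show ?thesis using a b by (intro bexI[of _ d]) auto
    qed
  qed
qed (use assms in \<open>simp_all add: has_ty_def\<close>)

lemma mo_eq_zero_iff:
  assumes "a \<in> \<N>" "b \<in> \<N>"
  shows "a \<ominus> b = \<zero> \<longleftrightarrow> a \<unlhd> b"
proof -
  from le_or_gt[OF assms] obtain c where c: "c \<in> \<N>" "b = a \<oplus> c \<or> a = b \<oplus> suc c" by blast
  from c(2) show ?thesis
  proof
    assume "b = a \<oplus> c"
    then show ?thesis using assms c mo_pl[of a c] by (auto simp: le_def)
  next
    assume a: "a = b \<oplus> suc c"
    then have ab: "a \<ominus> b = suc c" using assms c pl_mo[of "suc c" b] by simp
    then have "\<not> a \<unlhd> b" using assms c mo_pl by (metis le_def suc_neq_zero)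
    then show ?thesis using ab c by simp
  qed
qed

lemma lt_iff: "a \<in> \<N> \<Longrightarrow> b \<in> \<N> \<Longrightarrow> a \<lhd> b \<longleftrightarrow> suc a \<unlhd> b"
  by (simp add: lt_def mo_eq_zero_iff)

lemma le_refl [simp]: "a \<in> \<N> \<Longrightarrow> a \<unlhd> a"
  by (auto simp: le_def intro!: bexI[of _ \<zero>])

lemma le_trans: "a \<in> \<N> \<Longrightarrow> a \<unlhd> b \<Longrightarrow> b \<unlhd> c \<Longrightarrow> a \<unlhd> c"
  by (auto simp: le_def pl_assoc)

lemma le_pl:
  assumes "a \<in> \<N>" "b \<in> \<N>"
  shows "a \<unlhd> a \<oplus> b" "b \<unlhd> a \<oplus> b"
  using assms pl_commute[OF assms] unfolding le_def by blast+

lemma le_suc: "a \<in> \<N> \<Longrightarrow> a \<unlhd> suc a"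
  using le_pl(1)[of a "suc \<zero>"] by simp

lemma suc_le_suc: "a \<in> \<N> \<Longrightarrow> b \<in> \<N> \<Longrightarrow> suc a \<unlhd> suc b \<longleftrightarrow> a \<unlhd> b"
  by (auto simp: le_def)

lemma pl_mono:
  assumes "a \<in> \<N>" "c \<in> \<N>" "a \<unlhd> b"
  shows "a \<oplus> c \<unlhd> b \<oplus> c"
proof -
  obtain d where d: "d \<in> \<N>" "b = a \<oplus> d" using assms by (auto simp: le_def)
  have "b \<oplus> c = a \<oplus> c \<oplus> d"
    using assms d pl_commute[of d c] by (simp add: pl_assoc)
  then show ?thesis using d by (auto simp: le_def)
qed

lemma zero_le [simp]: "a \<in> \<N> \<Longrightarrow> \<zero> \<unlhd> a"
  by (auto simp: le_def)

text \<open>As 0 codes membership, the maximum codes intersection.\<close>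

lemma mx_eq_zero_iff:
  assumes "a \<in> \<N>" "b \<in> \<N>"
  shows "mx a b = \<zero> \<longleftrightarrow> a = \<zero> \<and> b = \<zero>"
  using assms(1)
proof (rule nat_cases)
  fix m assume "m \<in> \<N>" "a = suc m"
  then show ?thesis using assms by (simp add: mx_def)
qed (use assms in \<open>simp add: mx_def\<close>)

section \<open>Translates and finite sums as operations on elements\<close>

abbreviation Seq :: ty where "Seq \<equiv> N \<rightarrow>\<^sub>t N \<rightarrow>\<^sub>t N"

lemma rec_ap [simp]:
  assumes "y \<in> \<N>" "f \<in> D Seq"
  shows "I Rec \<bullet> \<zero> \<bullet> y \<bullet> f = y" "n \<in> \<N> \<Longrightarrow> I Rec \<bullet> suc n \<bullet> y \<bullet> f = f \<bullet> (I Rec \<bullet> n \<bullet> y \<bullet> f) \<bullet> n"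
    "n \<in> \<N> \<Longrightarrow> I Rec \<bullet> n \<bullet> y \<bullet> f \<in> \<N>"
  using rec_zero[OF assms] rec_suc[OF _ assms] rec_in[OF _ assms] by (simp_all add: rec_def)

lemma fun_eqI:
  "X \<in> D T1 \<Longrightarrow> Y \<in> D T1 \<Longrightarrow> (\<And>n. n \<in> \<N> \<Longrightarrow> X \<bullet> n = Y \<bullet> n) \<Longrightarrow> X = Y"
  by (rule ap_ext)

lemma seq_eqI:
  assumes "X \<in> D Seq" "Y \<in> D Seq" "\<And>m n. m \<in> \<N> \<Longrightarrow> n \<in> \<N> \<Longrightarrow> X \<bullet> m \<bullet> n = Y \<bullet> m \<bullet> n"
  shows "X = Y"
proof (rule ap_ext[OF assms(1,2)])
  show "X \<bullet> m = Y \<bullet> m" if "m \<in> \<N>" for m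
    by (rule fun_eqI) (use assms that in auto)
qed

text \<open>Any environment would serve: by extensionality the value of \<open>translate\<close>
  depends only on the values of its two arguments (\<open>eval_translate\<close>).\<close>

definition tr :: "'a \<Rightarrow> 'a \<Rightarrow> 'a" where
  "tr X n = eval (push T1 X (push N n env0)) (translate (Var T1 0) (Var N 0))"

lemma tr_in [simp, intro]: "X \<in> D T1 \<Longrightarrow> n \<in> \<N> \<Longrightarrow> tr X n \<in> D T1"
  by (auto simp: tr_def has_ty_def intro!: eval_in')

lemma eval_translate_ap:
  "X \<Colon> T1 \<Longrightarrow> n \<Colon> N \<Longrightarrow> env e \<Longrightarrow> m \<in> \<N> \<Longrightarrow>
    eval e (translate X n) \<bullet> m = eval e X \<bullet> (m \<oplus> eval e n)"
  by (simp add: translate_def has_ty_def)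

lemma tr_ap [simp]: "X \<in> D T1 \<Longrightarrow> n \<in> \<N> \<Longrightarrow> m \<in> \<N> \<Longrightarrow> tr X n \<bullet> m = X \<bullet> (m \<oplus> n)"
  by (simp add: tr_def eval_translate_ap)

lemma eval_in_T1: "X \<Colon> T1 \<Longrightarrow> env e \<Longrightarrow> eval e X \<in> D T1"
  and eval_in_N: "t \<Colon> N \<Longrightarrow> env e \<Longrightarrow> eval e t \<in> \<N>"
  by (auto simp: has_ty_def intro: eval_in')

lemma eval_translate [simp]:
  "X \<Colon> T1 \<Longrightarrow> n \<Colon> N \<Longrightarrow> env e \<Longrightarrow> eval e (translate X n) = tr (eval e X) (eval e n)"
  by (rule fun_eqI)
    (auto simp: eval_translate_ap eval_in_T1 eval_in_N has_ty_def intro!: eval_in')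

lemma tr_tr:
  assumes "X \<in> D T1" "m \<in> \<N>" "n \<in> \<N>"
  shows "tr (tr X n) m = tr X (m \<oplus> n)"
  by (rule fun_eqI) (use assms in \<open>auto simp: pl_assoc\<close>)

definition su :: "'a \<Rightarrow> 'a \<Rightarrow> 'a" where
  "su f n = eval (push T1 f (push N n env0)) (sum_upto (Var T1 0) (Var N 0))"

lemma eval_sum_upto [simp]:
  assumes "f \<Colon> T1" "l \<Colon> N" "env e"
  shows "eval e (sum_upto f l) = su (eval e f) (eval e l)"
proof -
  let ?g = "\<lambda>f. lam N (lam N (add_tm (Var N 1) (lift_tm N (lift_tm N f) \<cdot> (Succ \<cdot> Var N 0))))"
  let ?e = "push T1 (eval e f) (push N (eval e l) env0)"
  have e: "env ?e" using assms by (simp add: eval_in_T1 eval_in_N)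
  have "eval e (?g f) = eval ?e (?g (Var T1 0))"
    by (rule seq_eqI) (use assms e in \<open>auto simp: has_ty_def intro!: eval_in'\<close>)
  then show ?thesis by (simp add: sum_upto_def su_def)
qed

lemma su_zero [simp]: "f \<in> D T1 \<Longrightarrow> su f \<zero> = f \<bullet> \<zero>"
  and su_suc [simp]: "f \<in> D T1 \<Longrightarrow> n \<in> \<N> \<Longrightarrow> su f (suc n) = su f n \<oplus> f \<bullet> suc n"
  and su_in [simp, intro]: "f \<in> D T1 \<Longrightarrow> n \<in> \<N> \<Longrightarrow> su f n \<in> \<N>"
proof -
  let ?g = "lam N (lam N (add_tm (Var N 1) (lift_tm N (lift_tm N (Var T1 0)) \<cdot> (Succ \<cdot> Var N 0))))"
  let ?e = "\<lambda>n. push T1 f (push N n env0)"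
  have g: "eval (?e n) ?g \<in> D Seq" if "f \<in> D T1" "n \<in> \<N>" for n
    using that by (auto intro!: eval_in' simp: has_ty_def)
  have ap: "eval (?e n) ?g \<bullet> r \<bullet> i = r \<oplus> f \<bullet> suc i"
    if "f \<in> D T1" "n \<in> \<N>" "r \<in> \<N>" "i \<in> \<N>" for n r i
    using that by (simp add: has_ty_def)
  \<comment> \<open>The environment of the step function still contains n. By extensionality the
    step function is nevertheless the same element for every n, so the values at n and at its
    successor belong to one recursion.\<close>
  have indep: "eval (?e n) ?g = eval (?e \<zero>) ?g" if "f \<in> D T1" "n \<in> \<N>" for n
    by (rule seq_eqI) (use that g ap in auto)
  have su: "su f n = I Rec \<bullet> n \<bullet> (f \<bullet> \<zero>) \<bullet> eval (?e \<zero>) ?g" if "f \<in> D T1" "n \<in> \<N>" for n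
    using indep[OF that] by (simp add: su_def sum_upto_def)
  show "f \<in> D T1 \<Longrightarrow> su f \<zero> = f \<bullet> \<zero>" "f \<in> D T1 \<Longrightarrow> n \<in> \<N> \<Longrightarrow> su f n \<in> \<N>"
    "f \<in> D T1 \<Longrightarrow> n \<in> \<N> \<Longrightarrow> su f (suc n) = su f n \<oplus> f \<bullet> suc n"
    using g[of \<zero>] ap[of \<zero>] su by simp_all
qed

lemma comprehension1:
  assumes "wt t" "ty_of t = N" "env e"
  obtains X where "X \<in> D T1" "\<And>n. n \<in> \<N> \<Longrightarrow> X \<bullet> n = eval (push N n e) t"
  by (rule that[of "eval e (lam N t)"]) (use assms in \<open>auto intro!: eval_in'\<close>)

lemma comprehension2:
  assumes "wt t" "ty_of t = N" "env e"
  obtains X where "X \<in> D Seq" "\<And>m n. m \<in> \<N> \<Longrightarrow> n \<in> \<N> \<Longrightarrow> X \<bullet> m \<bullet> n = eval (push N n (push N m e)) t"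
  by (rule that[of "eval e (lam N (lam N t))"]) (use assms in \<open>auto intro!: eval_in'\<close>)

section \<open>Bounded intersections\<close>

text \<open>The value at n and m is the maximum of \<open>Z\<close> at j and m over all j up to n,
  that is, the intersection of the first n + 1 sets. The recursor produces numbers only, so the
  recursion runs separately for each point m. Inside the step, \<open>Var N 1\<close> is the maximum
  so far, \<open>Var N 0\<close> the counter and \<open>Var N 2\<close> the point m.\<close>

definition bint_tm :: "tm \<Rightarrow> tm" where
  "bint_tm Z = lam N (lam N (Rec \<cdot> Var N 1 \<cdot> (lift_tm N (lift_tm N Z) \<cdot> Zero \<cdot> Var N 0) \<cdot>
     lam N (lam N (max_tm (Var N 1)
       (lift_tm N (lift_tm N (lift_tm N (lift_tm N Z))) \<cdot> (Succ \<cdot> Var N 0) \<cdot> Var N 2)))))"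

lemma bint_tm [simp]: "wt (bint_tm Z) \<longleftrightarrow> Z \<Colon> Seq" "ty_of (bint_tm Z) = Seq"
  by (auto simp: bint_tm_def has_ty_def)

lemma eval_bint_tm:
  assumes "Z \<Colon> Seq" "env e" "n \<in> \<N>" "m \<in> \<N>"
  shows "eval e (bint_tm Z) \<bullet> \<zero> \<bullet> m = eval e Z \<bullet> \<zero> \<bullet> m"
    "eval e (bint_tm Z) \<bullet> suc n \<bullet> m = mx (eval e (bint_tm Z) \<bullet> n \<bullet> m) (eval e Z \<bullet> suc n \<bullet> m)"
proof -
  let ?g = "lam N (lam N (max_tm (Var N 1)
       (lift_tm N (lift_tm N (lift_tm N (lift_tm N Z))) \<cdot> (Succ \<cdot> Var N 0) \<cdot> Var N 2)))"
  let ?e = "\<lambda>n. push N m (push N n e)"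
  have Z: "eval e Z \<in> D Seq" using assms by (auto simp: has_ty_def intro: eval_in')
  have g: "eval (?e n) ?g \<in> D Seq" if "n \<in> \<N>" for n
    using that assms by (auto intro!: eval_in' simp: has_ty_def)
  have ap: "eval (?e n) ?g \<bullet> r \<bullet> i = mx r (eval e Z \<bullet> suc i \<bullet> m)" if "n \<in> \<N>" "r \<in> \<N>" "i \<in> \<N>" for n r i
    using that assms by (simp add: has_ty_def)
  have indep: "eval (?e n) ?g = eval (?e \<zero>) ?g" if "n \<in> \<N>" for n
    by (rule seq_eqI) (use that g ap in auto)
  have "eval e (bint_tm Z) \<bullet> n \<bullet> m = I Rec \<bullet> n \<bullet> (eval e Z \<bullet> \<zero> \<bullet> m) \<bullet> eval (?e n) ?g" if "n \<in> \<N>" for n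
    using that assms by (simp add: bint_tm_def has_ty_def)
  then have "eval e (bint_tm Z) \<bullet> n \<bullet> m = I Rec \<bullet> n \<bullet> (eval e Z \<bullet> \<zero> \<bullet> m) \<bullet> eval (?e \<zero>) ?g" if "n \<in> \<N>" for n
    using that indep[OF that] by metis
  then show "eval e (bint_tm Z) \<bullet> \<zero> \<bullet> m = eval e Z \<bullet> \<zero> \<bullet> m"
    "eval e (bint_tm Z) \<bullet> suc n \<bullet> m = mx (eval e (bint_tm Z) \<bullet> n \<bullet> m) (eval e Z \<bullet> suc n \<bullet> m)"
    using assms Z g[of \<zero>] ap[of \<zero>] by simp_all
qed

text \<open>Induction on the difference d of n and j, with j fixed, avoids a bounded quantifier over
  j in the induction formula.\<close>

lemma bint_tm_zeroD:
  assumes "Z \<Colon> Seq" "env e" "n \<in> \<N>" "m \<in> \<N>" "j \<in> \<N>" "j \<unlhd> n"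
    and "eval e (bint_tm Z) \<bullet> n \<bullet> m = \<zero>"
  shows "eval e Z \<bullet> j \<bullet> m = \<zero>"
proof -
  define z b where "z = eval e Z" and "b = eval e (bint_tm Z)"
  have zb: "z \<in> D Seq" "b \<in> D Seq"
    unfolding z_def b_def using assms(1,2) by (auto simp: has_ty_def intro!: eval_in')
  have b: "b \<bullet> \<zero> \<bullet> m = z \<bullet> \<zero> \<bullet> m" "\<And>n. n \<in> \<N> \<Longrightarrow> b \<bullet> suc n \<bullet> m = mx (b \<bullet> n \<bullet> m) (z \<bullet> suc n \<bullet> m)"
    unfolding z_def b_def using eval_bint_tm assms by auto
  obtain d where d: "d \<in> \<N>" "n = j \<oplus> d" using assms by (auto simp: le_def)
  have "b \<bullet> (j \<oplus> d) \<bullet> m = \<zero> \<longrightarrow> z \<bullet> j \<bullet> m = \<zero>"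
  proof (rule qf_induct[where P = "\<lambda>d. b \<bullet> (j \<oplus> d) \<bullet> m = \<zero> \<longrightarrow> z \<bullet> j \<bullet> m = \<zero>" and
        e = "push N j (push N m (push Seq b (push Seq z env0)))" and
        B = "(Var Seq 0 \<cdot> add_tm (Var N 1) (Var N 0) \<cdot> Var N 2 \<approx> Zero) \<^bold>\<longrightarrow>
          (Var Seq 1 \<cdot> Var N 1 \<cdot> Var N 2 \<approx> Zero)"])
    \<comment> \<open>The base case is index j itself, which enters the intersection as the initial
      value if j is zero and through a recursion step otherwise.\<close>
    from assms(5) show "b \<bullet> (j \<oplus> \<zero>) \<bullet> m = \<zero> \<longrightarrow> z \<bullet> j \<bullet> m = \<zero>"
      by (rule nat_cases) (use assms zb b in \<open>auto simp: mx_eq_zero_iff\<close>)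
  qed (use assms d zb b in \<open>auto simp: has_ty_def mx_eq_zero_iff\<close>)
  then show ?thesis using assms d by (simp add: z_def b_def)
qed

end

section \<open>Idempotent ultrafilters\<close>

text \<open>Sets are described by pointwise equations on arbitrary elements, not as values of
  particular terms, so that later arguments need neither environments nor the exact shape of a
  term.\<close>

locale idem_ultrafilter = rca_model +
  fixes U :: 'a
  assumes U_in [simp]: "U \<in> D T2"
    and U_compl: "X \<in> D T1 \<Longrightarrow> Y \<in> D T1 \<Longrightarrow> (\<And>n. n \<in> \<N> \<Longrightarrow> Y \<bullet> n = csg (X \<bullet> n)) \<Longrightarrow>
      U \<bullet> X = \<zero> \<or> U \<bullet> Y = \<zero>"
    and U_inter: "X \<in> D T1 \<Longrightarrow> Y \<in> D T1 \<Longrightarrow> Z \<in> D T1 \<Longrightarrow> U \<bullet> X = \<zero> \<Longrightarrow> U \<bullet> Y = \<zero> \<Longrightarrow>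
      (\<And>n. n \<in> \<N> \<Longrightarrow> Z \<bullet> n = mx (X \<bullet> n) (Y \<bullet> n)) \<Longrightarrow> U \<bullet> Z = \<zero>"
    and U_unbounded: "X \<in> D T1 \<Longrightarrow> U \<bullet> X = \<zero> \<Longrightarrow> n \<in> \<N> \<Longrightarrow> \<exists>k\<in>\<N>. n \<lhd> k \<and> X \<bullet> k = \<zero>"
    and U_idem: "X \<in> D T1 \<Longrightarrow> Y \<in> D T1 \<Longrightarrow> U \<bullet> X = \<zero> \<Longrightarrow>
      (\<And>n. n \<in> \<N> \<Longrightarrow> Y \<bullet> n = U \<bullet> tr X n) \<Longrightarrow> U \<bullet> Y = \<zero>"
begin

text \<open>Membership in \<open>U\<close> is an equation of type 0, so this induction on the
  possibly nonstandard number n is quantifier-free.\<close>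

lemma bint_tm_U:
  assumes "Z \<Colon> Seq" "env e" "n \<in> \<N>" and U: "\<And>j. j \<in> \<N> \<Longrightarrow> U \<bullet> (eval e Z \<bullet> j) = \<zero>"
  shows "U \<bullet> (eval e (bint_tm Z) \<bullet> n) = \<zero>"
proof -
  define z b where "z = eval e Z" and "b = eval e (bint_tm Z)"
  have zb: "z \<in> D Seq" "b \<in> D Seq"
    unfolding z_def b_def using assms(1,2) by (auto simp: has_ty_def intro!: eval_in')
  have b: "b \<bullet> \<zero> = z \<bullet> \<zero>" "\<And>n m. n \<in> \<N> \<Longrightarrow> m \<in> \<N> \<Longrightarrow> b \<bullet> suc n \<bullet> m = mx (b \<bullet> n \<bullet> m) (z \<bullet> suc n \<bullet> m)"
    using zb eval_bint_tm(2)[OF assms(1,2)] fun_eqI[OF _ _ eval_bint_tm(1)[OF assms(1,2)]]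
    by (simp_all add: z_def b_def)
  have "U \<bullet> (b \<bullet> n) = \<zero>"
  proof (rule qf_induct[where P = "\<lambda>n. U \<bullet> (b \<bullet> n) = \<zero>" and e = "push T2 U (push Seq b env0)" and
        B = "Var T2 0 \<cdot> (Var Seq 0 \<cdot> Var N 0) \<approx> Zero"])
    show "U \<bullet> (b \<bullet> \<zero>) = \<zero>" using U[of \<zero>] b(1) by (simp add: z_def)
    show "U \<bullet> (b \<bullet> suc n) = \<zero>" if "n \<in> \<N>" "U \<bullet> (b \<bullet> n) = \<zero>" for n
      by (rule U_inter[of "b \<bullet> n" "z \<bullet> suc n"])
        (use that zb b(2) U[of "suc n"] in \<open>simp_all add: z_def\<close>)
  qed (use zb assms(3) in \<open>simp_all add: has_ty_def\<close>)
  then show ?thesis by (simp add: b_def)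
qed

text \<open>The set \<open>X\<^sup>* = {n \<in> X. X - n \<in> U}\<close> of the Galvin-Glazer argument.\<close>

definition star :: "'a \<Rightarrow> 'a" where
  "star X = eval (push T1 X (push T2 U env0))
     (lam N (max_tm (Var T1 0 \<cdot> Var N 0) (Var T2 0 \<cdot> translate (Var T1 0) (Var N 0))))"

lemma star_in [simp, intro]: "X \<in> D T1 \<Longrightarrow> star X \<in> D T1"
  by (auto simp: star_def has_ty_def intro!: eval_in')

lemma star_ap: "X \<in> D T1 \<Longrightarrow> m \<in> \<N> \<Longrightarrow> star X \<bullet> m = mx (X \<bullet> m) (U \<bullet> tr X m)"
  by (simp add: star_def has_ty_def)

lemma star_zero_iff: "X \<in> D T1 \<Longrightarrow> m \<in> \<N> \<Longrightarrow> star X \<bullet> m = \<zero> \<longleftrightarrow> X \<bullet> m = \<zero> \<and> U \<bullet> tr X m = \<zero>"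
  by (simp add: star_ap mx_eq_zero_iff)

text \<open>The star is the intersection of X with the set of all n with X - n in \<open>U\<close>,
  and idempotence puts the latter into \<open>U\<close>.\<close>

lemma star_U:
  assumes "X \<in> D T1" "U \<bullet> X = \<zero>"
  shows "U \<bullet> star X = \<zero>"
proof -
  obtain Y where Y: "Y \<in> D T1" "\<And>n. n \<in> \<N> \<Longrightarrow> Y \<bullet> n = U \<bullet> tr X n"
    by (rule comprehension1[of "Var T2 0 \<cdot> translate (Var T1 0) (Var N 0)" "push T1 X (push T2 U env0)"])
      (use assms in \<open>auto simp: has_ty_def\<close>)
  show ?thesis
    by (rule U_inter[of X Y]) (use assms Y U_idem[of X Y] in \<open>auto simp: star_ap\<close>)
qed

text \<open>Translation commutes with the star. As v lies in the star of X, the translate of X by v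
  is in \<open>U\<close>, and \<open>star_U\<close> applies to that translate.\<close>

lemma star_translate_U:
  assumes "X \<in> D T1" "v \<in> \<N>" "star X \<bullet> v = \<zero>"
  shows "U \<bullet> tr (star X) v = \<zero>"
proof -
  have "tr (star X) v = star (tr X v)"
    by (rule fun_eqI) (use assms in \<open>auto simp: star_ap tr_tr\<close>)
  then show ?thesis
    using assms star_U[of "tr X v"] by (simp add: star_zero_iff)
qed

text \<open>\<open>S\<close> stands for the sequence of starred color classes. The set
  \<open>E\<close> at n collects what a new term must satisfy so that it, and its sum with any v up
  to n already in \<open>S\<close> at k, lies in \<open>S\<close> at k, for all k up to n
  simultaneously.\<close>

lemma extension_sets:
  assumes S: "S \<in> D Seq" "\<forall>k\<in>\<N>. U \<bullet> (S \<bullet> k) = \<zero>"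
    and S_tr: "\<forall>k\<in>\<N>. \<forall>v\<in>\<N>. S \<bullet> k \<bullet> v = \<zero> \<longrightarrow> U \<bullet> tr (S \<bullet> k) v = \<zero>"
  obtains E where "E \<in> D Seq" "\<And>n. n \<in> \<N> \<Longrightarrow> U \<bullet> (E \<bullet> n) = \<zero>"
    "\<And>n m k. \<lbrakk>n \<in> \<N>; m \<in> \<N>; k \<in> \<N>; E \<bullet> n \<bullet> m = \<zero>; k \<unlhd> n\<rbrakk> \<Longrightarrow> S \<bullet> k \<bullet> m = \<zero>"
    "\<And>n m k v. \<lbrakk>n \<in> \<N>; m \<in> \<N>; k \<in> \<N>; v \<in> \<N>; E \<bullet> n \<bullet> m = \<zero>; k \<unlhd> n; v \<unlhd> n; S \<bullet> k \<bullet> v = \<zero>\<rbrakk>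
      \<Longrightarrow> S \<bullet> k \<bullet> (m \<oplus> v) = \<zero>"
proof -
  let ?S = "Var Seq 0"
  \<comment> \<open>For fixed k this is a sequence of sets indexed by v. The recursor decides
    whether v is in \<open>S\<close> at k: if so, the set is \<open>S\<close> at k intersected with
    its translate by v, otherwise just \<open>S\<close> at k. Either way it is in \<open>U\<close>.
    Here k, v and m are \<open>Var N 2\<close>, \<open>Var N 1\<close> and \<open>Var N 0\<close>;
    below the two further abstractions k and m become \<open>Var N 4\<close> and
    \<open>Var N 2\<close>.\<close>
  define t where "t = lam N (lam N (max_tm (?S \<cdot> Var N 2 \<cdot> Var N 0)
    (Rec \<cdot> (?S \<cdot> Var N 2 \<cdot> Var N 1) \<cdot> (?S \<cdot> Var N 2 \<cdot> add_tm (Var N 0) (Var N 1)) \<cdot>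
      lam N (lam N (?S \<cdot> Var N 4 \<cdot> Var N 2)))))"
  have t: "t \<Colon> Seq" by (simp add: t_def has_ty_def)
  define e where "e n = push N n (push Seq S env0)" for n
  have e: "env (e n)" "e n Seq 0 = S" "e n N 0 = n" if "n \<in> \<N>" for n
    using S that by (simp_all add: e_def)
  define H where "H n k = eval (push N k (e n)) t" for n k
  have H_in: "H n k \<in> D Seq" if "n \<in> \<N>" "k \<in> \<N>" for n k
    using that t e by (auto simp: H_def has_ty_def intro!: eval_in')
  have g: "eval (push N m (push N v (push N k (e n)))) (lam N (lam N (?S \<cdot> Var N 4 \<cdot> Var N 2))) \<in> D Seq"
    if "n \<in> \<N>" "k \<in> \<N>" "v \<in> \<N>" "m \<in> \<N>" for n k v m
    using that e by (auto simp: has_ty_def intro!: eval_in')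
  have H_zero: "H n k \<bullet> v \<bullet> m = mx (S \<bullet> k \<bullet> m) (S \<bullet> k \<bullet> (m \<oplus> v))"
    if "n \<in> \<N>" "k \<in> \<N>" "v \<in> \<N>" "m \<in> \<N>" "S \<bullet> k \<bullet> v = \<zero>" for n k v m
    using that S e g by (simp add: H_def t_def has_ty_def)
  have H_suc: "H n k \<bullet> v \<bullet> m = mx (S \<bullet> k \<bullet> m) (S \<bullet> k \<bullet> m)"
    if n: "n \<in> \<N>" "k \<in> \<N>" "v \<in> \<N>" "m \<in> \<N>" and neq: "S \<bullet> k \<bullet> v \<noteq> \<zero>" for n k v m
  proof -
    have "S \<bullet> k \<bullet> v \<in> \<N>" using n S by simp
    then obtain i where "i \<in> \<N>" "S \<bullet> k \<bullet> v = suc i" by (rule nat_cases) (use neq in auto)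
    then show ?thesis using n S e g by (simp add: H_def t_def has_ty_def)
  qed
  have H_U: "U \<bullet> (H n k \<bullet> v) = \<zero>" if "n \<in> \<N>" "k \<in> \<N>" "v \<in> \<N>" for n k v
  proof (cases "S \<bullet> k \<bullet> v = \<zero>")
    case True
    then show ?thesis
      by (intro U_inter[of "S \<bullet> k" "tr (S \<bullet> k) v" "H n k \<bullet> v"])
        (use that S H_in H_zero S_tr[rule_format, OF that(2,3) True] in auto)
  next
    case False
    then show ?thesis
      by (intro U_inter[of "S \<bullet> k" "S \<bullet> k" "H n k \<bullet> v"]) (use that S H_in H_suc in auto)
  qed
  \<comment> \<open>Intersection over v up to n, as a function of k; below the abstraction over k,
    the bound n is \<open>Var N 1\<close>. A second intersection, over k up to the same n, then
    yields \<open>E\<close>.\<close>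
  define r where "r = lam N (bint_tm t \<cdot> Var N 1)"
  have r: "r \<Colon> Seq" using t by (simp add: r_def has_ty_def)
  have r_ap: "eval (e n) r \<bullet> k = eval (push N k (e n)) (bint_tm t) \<bullet> n" if "n \<in> \<N>" "k \<in> \<N>" for n k
    using that t e by (simp add: r_def has_ty_def)
  define E where "E = eval (push Seq S env0) (lam N (bint_tm r \<cdot> Var N 0))"
  have E_ap: "E \<bullet> n = eval (e n) (bint_tm r) \<bullet> n" if "n \<in> \<N>" for n
    using that r S by (simp add: E_def e_def has_ty_def)
  have E_zero: "eval (push N k (e n)) (bint_tm t) \<bullet> n \<bullet> m = \<zero>"
    if "n \<in> \<N>" "m \<in> \<N>" "k \<in> \<N>" "E \<bullet> n \<bullet> m = \<zero>" "k \<unlhd> n" for n m k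
    using bint_tm_zeroD[OF r e(1), of n n m k] that by (simp add: E_ap r_ap)
  have HE: "H n k \<bullet> v \<bullet> m = \<zero>"
    if "n \<in> \<N>" "m \<in> \<N>" "k \<in> \<N>" "v \<in> \<N>" "E \<bullet> n \<bullet> m = \<zero>" "k \<unlhd> n" "v \<unlhd> n" for n m k v
    using bint_tm_zeroD[OF t _ _ _ _ _ E_zero] that e by (simp add: H_def)
  show thesis
  proof (rule that[of E])
    show "E \<in> D Seq" using r S by (auto simp: E_def has_ty_def intro!: eval_in')
    show "U \<bullet> (E \<bullet> n) = \<zero>" if "n \<in> \<N>" for n
      using that e t H_U by (auto simp: E_ap r_ap H_def intro!: bint_tm_U[OF r] bint_tm_U[OF t])
    show "S \<bullet> k \<bullet> (m \<oplus> v) = \<zero>" if "n \<in> \<N>" "m \<in> \<N>" "k \<in> \<N>" "v \<in> \<N>" "E \<bullet> n \<bullet> m = \<zero>" "k \<unlhd> n" "v \<unlhd> n"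
      "S \<bullet> k \<bullet> v = \<zero>" for n m k v
      using HE[OF that(1-7)] H_zero[OF that(1,3,4,2,8)] that S by (simp add: mx_eq_zero_iff)
    \<comment> \<open>Both cases of the definition of H are contained in \<open>S\<close> at k, so a
      single v suffices; v = 0 is below every n.\<close>
    show "S \<bullet> k \<bullet> m = \<zero>" if "n \<in> \<N>" "m \<in> \<N>" "k \<in> \<N>" "E \<bullet> n \<bullet> m = \<zero>" "k \<unlhd> n" for n m k
      using HE[OF that(1-3) _ that(4,5), of \<zero>] H_zero[of n k \<zero> m] H_suc[of n k \<zero> m] that S
      by (cases "S \<bullet> k \<bullet> \<zero> = \<zero>") (auto simp: mx_eq_zero_iff)
  qed
qed

end

section \<open>Color classes in the ultrafilter and the Hindman sequence\<close>

context idem_ultrafilter begin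

text \<open>Read as a set, c_k is its own class of color 0. The recursor on the number
  \<open>U\<close> assigns to c_k chooses between this class and its complement, which yields one
  object \<open>A\<close> for all k.\<close>

lemma color_classes:
  assumes c: "c \<in> D Seq"
  obtains A where "A \<in> D Seq" "\<And>k. k \<in> \<N> \<Longrightarrow> U \<bullet> (A \<bullet> k) = \<zero>"
    "\<And>k. k \<in> \<N> \<Longrightarrow> (\<forall>n\<in>\<N>. A \<bullet> k \<bullet> n = c \<bullet> k \<bullet> n) \<or> (\<forall>n\<in>\<N>. A \<bullet> k \<bullet> n = csg (c \<bullet> k \<bullet> n))"
proof -
  let ?c = "Var Seq 0"
  let ?g = "lam N (lam N (cosg (?c \<cdot> Var N 3 \<cdot> Var N 2)))"
  let ?e = "push Seq c (push T2 U env0)"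
  obtain A where A: "A \<in> D Seq" and ap: "\<And>k n. k \<in> \<N> \<Longrightarrow> n \<in> \<N> \<Longrightarrow> A \<bullet> k \<bullet> n =
      eval (push N n (push N k ?e)) (Rec \<cdot> (Var T2 0 \<cdot> (?c \<cdot> Var N 1)) \<cdot> (?c \<cdot> Var N 1 \<cdot> Var N 0) \<cdot> ?g)"
    by (rule comprehension2[of "Rec \<cdot> (Var T2 0 \<cdot> (?c \<cdot> Var N 1)) \<cdot> (?c \<cdot> Var N 1 \<cdot> Var N 0) \<cdot> ?g" ?e])
      (use c in \<open>auto simp: has_ty_def\<close>)
  have g: "eval (push N n (push N k ?e)) ?g \<in> D Seq" if "n \<in> \<N>" "k \<in> \<N>" for n k
    using that c by (auto simp: has_ty_def intro!: eval_in')
  have zero: "A \<bullet> k \<bullet> n = c \<bullet> k \<bullet> n" if "k \<in> \<N>" "n \<in> \<N>" "U \<bullet> (c \<bullet> k) = \<zero>" for k n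
    using that c g by (simp add: ap has_ty_def)
  have nonzero: "A \<bullet> k \<bullet> n = csg (c \<bullet> k \<bullet> n)" if k: "k \<in> \<N>" and n: "n \<in> \<N>" and neq: "U \<bullet> (c \<bullet> k) \<noteq> \<zero>" for k n
  proof -
    have "U \<bullet> (c \<bullet> k) \<in> \<N>" using c k by simp
    then obtain i where "i \<in> \<N>" "U \<bullet> (c \<bullet> k) = suc i" by (rule nat_cases) (use neq in auto)
    then show ?thesis using k n c g by (simp add: ap has_ty_def)
  qed
  have "U \<bullet> (A \<bullet> k) = \<zero>" if "k \<in> \<N>" for k
  proof (cases "U \<bullet> (c \<bullet> k) = \<zero>")
    case True
    then have "A \<bullet> k = c \<bullet> k" using that A c zero by (intro fun_eqI[of "A \<bullet> k"]) auto
    then show ?thesis using True by simp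
  next
    case False
    then show ?thesis using that A c nonzero U_compl[of "c \<bullet> k" "A \<bullet> k"] by auto
  qed
  with A zero nonzero show thesis by (intro that[of A]) blast+
qed

text \<open>The choice schema takes arguments of type 1, so a number n is passed as the value at 0
  of a function; restricting the functional to constant functions gives \<open>g\<close>.\<close>

lemma choice_function:
  assumes E: "E \<in> D Seq" "\<forall>n\<in>\<N>. U \<bullet> (E \<bullet> n) = \<zero>"
  obtains g where "g \<in> D T1" "\<And>n. n \<in> \<N> \<Longrightarrow> n \<lhd> g \<bullet> n \<and> E \<bullet> n \<bullet> (g \<bullet> n) = \<zero>"
proof -
  let ?n = "Var T1 0 \<cdot> Zero"
  have "\<exists>F\<in>D T2. \<forall>f\<in>D T1. sat (push N (F \<bullet> f) (push T1 f (push Seq E env0)))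
      ((?n \<prec> Var N 0) \<^bold>\<and> (Var Seq 0 \<cdot> ?n \<cdot> Var N 0 \<approx> Zero))"
    by (rule QF_AC) (use E U_unbounded[of "E \<bullet> _"] in \<open>auto simp: has_ty_def\<close>)
  then obtain F where F: "F \<in> D T2" "\<And>f. f \<in> D T1 \<Longrightarrow> f \<bullet> \<zero> \<lhd> F \<bullet> f \<and> E \<bullet> (f \<bullet> \<zero>) \<bullet> (F \<bullet> f) = \<zero>"
    by auto
  let ?K = "\<lambda>n. eval (push N n (push T2 F env0)) (lam N (Var N 1))"
  have K: "?K n \<in> D T1" "?K n \<bullet> \<zero> = n" if "n \<in> \<N>" for n
    using that F by (auto intro!: eval_in')
  obtain g where "g \<in> D T1" "\<And>n. n \<in> \<N> \<Longrightarrow> g \<bullet> n = F \<bullet> ?K n"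
    by (rule comprehension1[of "Var T2 0 \<cdot> lam N (Var N 1)" "push T2 F env0"]) (use F in auto)
  then show thesis using that[of g] F(2)[OF K(1)] K(2) by auto
qed

lemma partial_sums:
  assumes g: "g \<in> D T1"
  obtains P where "P \<in> D T1" "P \<bullet> \<zero> = \<zero>" "\<And>n. n \<in> \<N> \<Longrightarrow> P \<bullet> suc n = P \<bullet> n \<oplus> g \<bullet> (P \<bullet> n)"
proof -
  let ?h = "lam N (lam N (add_tm (Var N 1) (Var T1 0 \<cdot> Var N 1)))"
  let ?e = "push T1 g env0"
  have e: "env ?e" using g by simp
  obtain P where P: "P \<in> D T1" and ap: "\<And>n. n \<in> \<N> \<Longrightarrow> P \<bullet> n = eval (push N n ?e) (Rec \<cdot> Var N 0 \<cdot> Zero \<cdot> ?h)"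
    by (rule comprehension1[of "Rec \<cdot> Var N 0 \<cdot> Zero \<cdot> ?h" ?e]) (use e in \<open>auto simp: has_ty_def\<close>)
  have h: "eval (push N n ?e) ?h \<in> D Seq" if "n \<in> \<N>" for n
    using that e by (auto simp: has_ty_def intro!: eval_in')
  have h_ap: "eval (push N n ?e) ?h \<bullet> r \<bullet> i = r \<oplus> g \<bullet> r" if "n \<in> \<N>" "r \<in> \<N>" "i \<in> \<N>" for n r i
    using that e by (simp add: has_ty_def)
  have indep: "eval (push N n ?e) ?h = eval (push N \<zero> ?e) ?h" if "n \<in> \<N>" for n
    by (rule seq_eqI) (use that h h_ap in auto)
  have P_rec: "P \<bullet> n = I Rec \<bullet> n \<bullet> \<zero> \<bullet> eval (push N \<zero> ?e) ?h" if "n \<in> \<N>" for n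
    using ap[OF that] indep[OF that] by simp
  show thesis
    by (rule that[of P]) (use P h[of \<zero>] h_ap[of \<zero>] in \<open>auto simp: P_rec\<close>)
qed

text \<open>With \<open>P(n) = x\<^sub>0 + \<dots> + x\<^sub>n\<^sub>-\<^sub>1\<close>, all finite sums of \<open>x\<^sub>0, \<dots>, x\<^sub>n\<^sub>-\<^sub>1\<close> are at most \<open>P(n)\<close>,
  and \<open>x\<^sub>n\<close> is chosen depending on \<open>P(n)\<close> only.\<close>

lemma hindman_sequence:
  assumes S: "S \<in> D Seq" "\<forall>k\<in>\<N>. U \<bullet> (S \<bullet> k) = \<zero>"
    and S_tr: "\<forall>k\<in>\<N>. \<forall>v\<in>\<N>. S \<bullet> k \<bullet> v = \<zero> \<longrightarrow> U \<bullet> tr (S \<bullet> k) v = \<zero>"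
  obtains x P where "x \<in> D T1" "P \<in> D T1" "\<And>n. n \<in> \<N> \<Longrightarrow> P \<bullet> suc n = P \<bullet> n \<oplus> x \<bullet> n"
    "\<And>n. n \<in> \<N> \<Longrightarrow> n \<unlhd> P \<bullet> n" "\<And>n. n \<in> \<N> \<Longrightarrow> P \<bullet> n \<lhd> x \<bullet> n"
    "\<And>n k. n \<in> \<N> \<Longrightarrow> k \<in> \<N> \<Longrightarrow> k \<unlhd> P \<bullet> n \<Longrightarrow> S \<bullet> k \<bullet> (x \<bullet> n) = \<zero>"
    "\<And>n k v. n \<in> \<N> \<Longrightarrow> k \<in> \<N> \<Longrightarrow> v \<in> \<N> \<Longrightarrow> k \<unlhd> P \<bullet> n \<Longrightarrow> v \<unlhd> P \<bullet> n \<Longrightarrow> S \<bullet> k \<bullet> v = \<zero> \<Longrightarrow>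
      S \<bullet> k \<bullet> (v \<oplus> x \<bullet> n) = \<zero>"
proof (rule extension_sets[OF S S_tr])
  fix E
  assume E: "E \<in> D Seq" "\<And>n. n \<in> \<N> \<Longrightarrow> U \<bullet> (E \<bullet> n) = \<zero>"
    and E1: "\<And>n m k. \<lbrakk>n \<in> \<N>; m \<in> \<N>; k \<in> \<N>; E \<bullet> n \<bullet> m = \<zero>; k \<unlhd> n\<rbrakk> \<Longrightarrow> S \<bullet> k \<bullet> m = \<zero>"
    and E2: "\<And>n m k v. \<lbrakk>n \<in> \<N>; m \<in> \<N>; k \<in> \<N>; v \<in> \<N>; E \<bullet> n \<bullet> m = \<zero>; k \<unlhd> n; v \<unlhd> n; S \<bullet> k \<bullet> v = \<zero>\<rbrakk>
      \<Longrightarrow> S \<bullet> k \<bullet> (m \<oplus> v) = \<zero>"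
  obtain g where g: "g \<in> D T1" "\<And>n. n \<in> \<N> \<Longrightarrow> n \<lhd> g \<bullet> n \<and> E \<bullet> n \<bullet> (g \<bullet> n) = \<zero>"
    using choice_function[of E] E by metis
  obtain P where P: "P \<in> D T1" "P \<bullet> \<zero> = \<zero>" "\<And>n. n \<in> \<N> \<Longrightarrow> P \<bullet> suc n = P \<bullet> n \<oplus> g \<bullet> (P \<bullet> n)"
    using partial_sums[OF g(1)] by metis
  obtain x where x: "x \<in> D T1" "\<And>n. n \<in> \<N> \<Longrightarrow> x \<bullet> n = g \<bullet> (P \<bullet> n)"
    by (rule comprehension1[of "Var T1 0 \<cdot> (Var T1 1 \<cdot> Var N 0)" "push T1 g (push T1 P env0)"])
      (use g P in auto)
  have P_less: "P \<bullet> n \<lhd> x \<bullet> n" and Ex: "E \<bullet> (P \<bullet> n) \<bullet> (x \<bullet> n) = \<zero>" if "n \<in> \<N>" for n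
    using g(2)[of "P \<bullet> n"] x P that by auto
  show thesis
  proof (rule that[of x P])
    show "P \<bullet> suc n = P \<bullet> n \<oplus> x \<bullet> n" if "n \<in> \<N>" for n using P x that by simp
    \<comment> \<open>Hence k is at most P(i) for all i from k on, so the tail starting at k
      respects the k-th coloring.\<close>
    show "n \<unlhd> P \<bullet> n" if "n \<in> \<N>" for n
    proof (rule qf_induct[where P = "\<lambda>n. n \<unlhd> P \<bullet> n" and e = "push T1 P env0" and
          B = "monus_tm (Var N 0) (Var T1 0 \<cdot> Var N 0) \<approx> Zero"])
      show "suc n \<unlhd> P \<bullet> suc n" if "n \<in> \<N>" "n \<unlhd> P \<bullet> n" for n
      proof -
        have "suc n \<unlhd> suc (P \<bullet> n)" using that P by (simp add: suc_le_suc)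
        moreover have "suc (P \<bullet> n) \<unlhd> x \<bullet> n" using P_less[OF that(1)] that x(1) P(1) by (simp add: lt_iff)
        moreover have "x \<bullet> n \<unlhd> P \<bullet> suc n" using that P x g(1) le_pl(2)[of "P \<bullet> n" "x \<bullet> n"] by simp
        ultimately show ?thesis using that P le_trans[of "suc n"] by (metis I_in(2) ap_in_simps(1))
      qed
    qed (use that P in \<open>simp_all add: has_ty_def mo_eq_zero_iff\<close>)
    show "S \<bullet> k \<bullet> (x \<bullet> n) = \<zero>" if "n \<in> \<N>" "k \<in> \<N>" "k \<unlhd> P \<bullet> n" for n k
      using E1[of "P \<bullet> n" "x \<bullet> n" k] Ex that P(1) x(1) by simp
    show "S \<bullet> k \<bullet> (v \<oplus> x \<bullet> n) = \<zero>"
      if "n \<in> \<N>" "k \<in> \<N>" "v \<in> \<N>" "k \<unlhd> P \<bullet> n" "v \<unlhd> P \<bullet> n" "S \<bullet> k \<bullet> v = \<zero>" for n k v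
      using E2[of "P \<bullet> n" "x \<bullet> n" k v] Ex that P(1) x(1) pl_commute[of "x \<bullet> n" v] by simp
  qed (use x P P_less in auto)
qed

text \<open>In the last conclusion \<open>f\<close> lists the summands and \<open>su f l\<close> is
  a finite sum of the tail from k on; \<open>f\<close> may be any element with these values, so it
  can be read off from the formula later.\<close>

lemma iterated_hindman:
  assumes S: "S \<in> D Seq" "\<forall>k\<in>\<N>. U \<bullet> (S \<bullet> k) = \<zero>"
    and S_tr: "\<forall>k\<in>\<N>. \<forall>v\<in>\<N>. S \<bullet> k \<bullet> v = \<zero> \<longrightarrow> U \<bullet> tr (S \<bullet> k) v = \<zero>"
  obtains x where "x \<in> D T1" "\<And>i j. i \<in> \<N> \<Longrightarrow> j \<in> \<N> \<Longrightarrow> i \<lhd> j \<Longrightarrow> x \<bullet> i \<lhd> x \<bullet> j"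
    "\<And>k s f l. k \<in> \<N> \<Longrightarrow> s \<in> D T1 \<Longrightarrow> f \<in> D T1 \<Longrightarrow> l \<in> \<N> \<Longrightarrow>
      (\<And>j. j \<in> \<N> \<Longrightarrow> j \<lhd> l \<Longrightarrow> s \<bullet> j \<lhd> s \<bullet> suc j) \<Longrightarrow>
      (\<And>j. j \<in> \<N> \<Longrightarrow> f \<bullet> j = x \<bullet> (s \<bullet> j \<oplus> k)) \<Longrightarrow> S \<bullet> k \<bullet> su f l = \<zero>"
proof (rule hindman_sequence[OF S S_tr])
  fix x P
  assume x: "x \<in> D T1" and P: "P \<in> D T1" and P_suc: "\<And>n. n \<in> \<N> \<Longrightarrow> P \<bullet> suc n = P \<bullet> n \<oplus> x \<bullet> n"
    and P_ge: "\<And>n. n \<in> \<N> \<Longrightarrow> n \<unlhd> P \<bullet> n" and P_less: "\<And>n. n \<in> \<N> \<Longrightarrow> P \<bullet> n \<lhd> x \<bullet> n"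
    and S1: "\<And>n k. n \<in> \<N> \<Longrightarrow> k \<in> \<N> \<Longrightarrow> k \<unlhd> P \<bullet> n \<Longrightarrow> S \<bullet> k \<bullet> (x \<bullet> n) = \<zero>"
    and S2: "\<And>n k v. n \<in> \<N> \<Longrightarrow> k \<in> \<N> \<Longrightarrow> v \<in> \<N> \<Longrightarrow> k \<unlhd> P \<bullet> n \<Longrightarrow> v \<unlhd> P \<bullet> n \<Longrightarrow> S \<bullet> k \<bullet> v = \<zero> \<Longrightarrow>
      S \<bullet> k \<bullet> (v \<oplus> x \<bullet> n) = \<zero>"
  have P_in: "P \<bullet> n \<in> \<N>" and x_in: "x \<bullet> n \<in> \<N>" if "n \<in> \<N>" for n using P x that by auto
  have mono: "P \<bullet> i \<unlhd> P \<bullet> j" if "i \<in> \<N>" "j \<in> \<N>" "i \<unlhd> j" for i j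
  proof -
    obtain d where d: "d \<in> \<N>" "j = i \<oplus> d" using \<open>i \<unlhd> j\<close> by (auto simp: le_def)
    have "P \<bullet> i \<unlhd> P \<bullet> (i \<oplus> d)"
    proof (rule qf_induct[where P = "\<lambda>d. P \<bullet> i \<unlhd> P \<bullet> (i \<oplus> d)" and e = "push N i (push T1 P env0)" and
          B = "monus_tm (Var T1 0 \<cdot> Var N 1) (Var T1 0 \<cdot> add_tm (Var N 1) (Var N 0)) \<approx> Zero"])
      show "P \<bullet> i \<unlhd> P \<bullet> (i \<oplus> suc d)" if "d \<in> \<N>" "P \<bullet> i \<unlhd> P \<bullet> (i \<oplus> d)" for d
        using le_trans[OF _ that(2), of "P \<bullet> suc (i \<oplus> d)"] le_pl(1)[of "P \<bullet> (i \<oplus> d)" "x \<bullet> (i \<oplus> d)"]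
          that \<open>i \<in> \<N>\<close> P_in x_in by (simp add: P_suc)
    qed (use that d P in \<open>simp_all add: has_ty_def mo_eq_zero_iff\<close>)
    then show ?thesis using d by simp
  qed
  show thesis
  proof (rule that[of x])
    \<comment> \<open>The chain is x_i \<unlhd> P(i + 1) \<unlhd> P(j) \<lhd> x_j.\<close>
    show "x \<bullet> i \<lhd> x \<bullet> j" if ij: "i \<in> \<N>" "j \<in> \<N>" "i \<lhd> j" for i j
    proof -
      have "x \<bullet> i \<unlhd> P \<bullet> suc i" using ij le_pl(2) P_in x_in by (simp add: P_suc)
      moreover have "P \<bullet> suc i \<unlhd> P \<bullet> j" using ij mono by (simp add: lt_iff)
      ultimately have "x \<bullet> i \<unlhd> P \<bullet> j" using le_trans ij x_in by blast
      then have "suc (x \<bullet> i) \<unlhd> suc (P \<bullet> j)" using ij P_in x_in by (simp add: suc_le_suc)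
      moreover have "suc (P \<bullet> j) \<unlhd> x \<bullet> j" using ij P_less P_in x_in by (simp add: lt_iff)
      ultimately have "suc (x \<bullet> i) \<unlhd> x \<bullet> j" using le_trans[of "suc (x \<bullet> i)"] ij x_in by simp
      then show ?thesis using ij x_in by (simp add: lt_iff)
    qed
    fix k s f l
    assume k: "k \<in> \<N>" and s: "s \<in> D T1" and f: "f \<in> D T1" and l: "l \<in> \<N>"
      and s_less: "\<And>j. j \<in> \<N> \<Longrightarrow> j \<lhd> l \<Longrightarrow> s \<bullet> j \<lhd> s \<bullet> suc j"
      and f_ap: "\<And>j. j \<in> \<N> \<Longrightarrow> f \<bullet> j = x \<bullet> (s \<bullet> j \<oplus> k)"
    have s_in: "s \<bullet> j \<in> \<N>" if "j \<in> \<N>" for j using s that by simp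
    have su_in: "su f j \<in> \<N>" if "j \<in> \<N>" for j using f that by simp
    have k_le: "k \<unlhd> P \<bullet> (s \<bullet> j \<oplus> k)" if "j \<in> \<N>" for j
      using le_trans[OF k le_pl(2)[OF s_in[OF that] k] P_ge] that k s_in by simp
    \<comment> \<open>The premise restricts the induction to indices up to l, because
      \<open>s\<close> is known to increase only that far. The bound by P makes each partial sum an
      admissible v for the next summand: s(j) + k + 1 is at most s(j + 1) + k, and P is
      monotone.\<close>
    have "l \<unlhd> l \<longrightarrow> S \<bullet> k \<bullet> su f l = \<zero> \<and> su f l \<unlhd> P \<bullet> suc (s \<bullet> l \<oplus> k)"
    proof (rule qf_induct[where P = "\<lambda>j. j \<unlhd> l \<longrightarrow> S \<bullet> k \<bullet> su f j = \<zero> \<and> su f j \<unlhd> P \<bullet> suc (s \<bullet> j \<oplus> k)"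
          and e = "push N l (push N k (push T1 f (push T1 P (push T1 s (push Seq S env0)))))" and
          B = "(monus_tm (Var N 0) (Var N 1) \<approx> Zero) \<^bold>\<longrightarrow>
            (Var Seq 0 \<cdot> Var N 2 \<cdot> sum_upto (Var T1 0) (Var N 0) \<approx> Zero) \<^bold>\<and>
            (monus_tm (sum_upto (Var T1 0) (Var N 0)) (Var T1 1 \<cdot> (Succ \<cdot> add_tm (Var T1 2 \<cdot> Var N 0) (Var N 2))) \<approx> Zero)"])
      show "\<zero> \<unlhd> l \<longrightarrow> S \<bullet> k \<bullet> su f \<zero> = \<zero> \<and> su f \<zero> \<unlhd> P \<bullet> suc (s \<bullet> \<zero> \<oplus> k)"
        using S1[of "s \<bullet> \<zero> \<oplus> k" k] k_le[of \<zero>] le_pl(2)[of "P \<bullet> (s \<bullet> \<zero> \<oplus> k)" "x \<bullet> (s \<bullet> \<zero> \<oplus> k)"] k f s_in P_in x_in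
        by (simp add: f_ap P_suc)
      fix j
      assume j: "j \<in> \<N>" and IH: "j \<unlhd> l \<longrightarrow> S \<bullet> k \<bullet> su f j = \<zero> \<and> su f j \<unlhd> P \<bullet> suc (s \<bullet> j \<oplus> k)"
      show "suc j \<unlhd> l \<longrightarrow> S \<bullet> k \<bullet> su f (suc j) = \<zero> \<and> su f (suc j) \<unlhd> P \<bullet> suc (s \<bullet> suc j \<oplus> k)"
      proof (rule HOL.impI)
        assume jl: "suc j \<unlhd> l"
        let ?t = "s \<bullet> suc j \<oplus> k"
        have t: "?t \<in> \<N>" using j k s_in by simp
        have "j \<unlhd> l" using le_trans[OF j le_suc[OF j] jl] .
        then have IH': "S \<bullet> k \<bullet> su f j = \<zero>" "su f j \<unlhd> P \<bullet> suc (s \<bullet> j \<oplus> k)" using IH by auto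
        have "suc (s \<bullet> j) \<unlhd> s \<bullet> suc j" using s_less[OF j] jl j l s_in by (simp add: lt_iff)
        then have "suc (s \<bullet> j \<oplus> k) \<unlhd> ?t" using pl_mono[of "suc (s \<bullet> j)" k] j k s_in by simp
        then have "P \<bullet> suc (s \<bullet> j \<oplus> k) \<unlhd> P \<bullet> ?t" using mono t j k s_in by simp
        with IH'(2) have le: "su f j \<unlhd> P \<bullet> ?t" using le_trans su_in j by blast
        show "S \<bullet> k \<bullet> su f (suc j) = \<zero> \<and> su f (suc j) \<unlhd> P \<bullet> suc ?t"
          using S2[OF t k su_in[OF j] k_le le IH'(1)] pl_mono[OF su_in[OF j] x_in[OF t] le] j f t
          by (simp add: f_ap P_suc)
      qed
    qed (use k s f l P S su_in s_in in \<open>simp_all add: has_ty_def mo_eq_zero_iff\<close>)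
    then show "S \<bullet> k \<bullet> su f l = \<zero>" using l by simp
  qed (rule x)
qed

end

section \<open>Semantic content of \<open>U_idem\<close> and \<open>IHT\<close>\<close>

context rca_model begin

lemma idem_ultrafilter_exists:
  assumes e: "env e" and sat: "sat e U_idem"
  shows "\<exists>U. idem_ultrafilter D (\<bullet>) I U"
proof -
  obtain U where U: "U \<in> D T2"
    and compl: "\<forall>X\<in>D T1. U \<bullet> X = \<zero> \<or>
      U \<bullet> eval (push T1 X (push T2 U e)) (compl_set (Var T1 0)) = \<zero>"
    and inter: "\<forall>X\<in>D T1. \<forall>Y\<in>D T1. U \<bullet> X = \<zero> \<and> U \<bullet> Y = \<zero> \<longrightarrow>
      U \<bullet> eval (push T1 Y (push T1 X (push T2 U e))) (inter_set (Var T1 1) (Var T1 0)) = \<zero>"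
    and unbounded: "\<forall>X\<in>D T1. U \<bullet> X = \<zero> \<longrightarrow> (\<forall>n\<in>\<N>. \<exists>k\<in>\<N>. n \<lhd> k \<and> X \<bullet> k = \<zero>)"
    and idem: "\<forall>X\<in>D T1. U \<bullet> X = \<zero> \<longrightarrow>
      U \<bullet> eval (push T1 X (push T2 U e)) (idem_set (Var T2 0) (Var T1 0)) = \<zero>"
    using sat by (auto simp: U_idem_def Let_def mem_def)
  show ?thesis
  proof (rule exI, unfold_locales)
    show "U \<in> D T2" by (rule U)
    fix X Y assume X: "X \<in> D T1" and Y: "Y \<in> D T1"
    show "U \<bullet> X = \<zero> \<or> U \<bullet> Y = \<zero>" if "\<And>n. n \<in> \<N> \<Longrightarrow> Y \<bullet> n = csg (X \<bullet> n)"
    proof -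
      have "eval (push T1 X (push T2 U e)) (compl_set (Var T1 0)) = Y"
        by (rule fun_eqI)
          (use e U X Y that in \<open>auto simp: compl_set_def has_ty_def intro!: eval_in'\<close>)
      then show ?thesis using compl X by auto
    qed
    show "U \<bullet> Z = \<zero>" if "Z \<in> D T1" "U \<bullet> X = \<zero>" "U \<bullet> Y = \<zero>"
      "\<And>n. n \<in> \<N> \<Longrightarrow> Z \<bullet> n = mx (X \<bullet> n) (Y \<bullet> n)" for Z
    proof -
      have "eval (push T1 Y (push T1 X (push T2 U e))) (inter_set (Var T1 1) (Var T1 0)) = Z"
        by (rule fun_eqI)
          (use e U X Y that in \<open>auto simp: inter_set_def has_ty_def intro!: eval_in'\<close>)
      then show ?thesis using inter X Y that by auto
    qed
    show "U \<bullet> Y = \<zero>" if "U \<bullet> X = \<zero>" "\<And>n. n \<in> \<N> \<Longrightarrow> Y \<bullet> n = U \<bullet> tr X n"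
    proof -
      have "lift_tm N (Var T1 0) \<Colon> T1" "lift_tm N (Var T2 0) \<Colon> T2"
        by (simp_all add: subst_has_ty)
      then have "eval (push T1 X (push T2 U e)) (idem_set (Var T2 0) (Var T1 0)) = Y"
        by (intro fun_eqI[of _ Y])
          (use e U X Y that in \<open>auto simp: idem_set_def has_ty_def intro!: eval_in'\<close>)
      then show ?thesis using idem X that by auto
    qed
    show "\<exists>k\<in>\<N>. n \<lhd> k \<and> X \<bullet> k = \<zero>" if "U \<bullet> X = \<zero>" "n \<in> \<N>" for n
      using unbounded X that by blast
  qed
qed

text \<open>The abstracted summand term of the formula becomes an element \<open>f\<close>, which is
  the form in which \<open>iterated_hindman\<close> accepts a finite sum.\<close>

lemma sat_in_FS:
  assumes "sat e (in_FS y x)" "x \<Colon> T1" "y \<Colon> N" "env e"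
  obtains s l f where "s \<in> D T1" "l \<in> \<N>" "f \<in> D T1"
    "\<And>j. j \<in> \<N> \<Longrightarrow> j \<lhd> l \<Longrightarrow> s \<bullet> j \<lhd> s \<bullet> suc j"
    "\<And>j. j \<in> \<N> \<Longrightarrow> f \<bullet> j = eval e x \<bullet> (s \<bullet> j)" "eval e y = su f l"
proof -
  let ?f = "lam N (lift_tm N (lift_tm N (lift_tm T1 x)) \<cdot> (Var T1 0 \<cdot> Var N 0))"
  have f: "?f \<Colon> T1" using assms(2) by (simp add: has_ty_def)
  obtain s l where sl: "s \<in> D T1" "l \<in> \<N>" "\<And>j. j \<in> \<N> \<Longrightarrow> j \<lhd> l \<Longrightarrow> s \<bullet> j \<lhd> s \<bullet> suc j"
    and y: "eval e y = eval (push N l (push T1 s e)) (sum_upto ?f (Var N 0))"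
    using assms(1) by (auto simp: in_FS_def Let_def)
  let ?e = "push N l (push T1 s e)"
  have e: "env ?e" using sl assms(4) by simp
  show thesis
  proof (rule that[of s l "eval ?e ?f"])
    show "eval e y = su (eval ?e ?f) l" using y eval_sum_upto[OF f _ e, of "Var N 0"] by simp
    show "eval ?e ?f \<in> D T1" using f e by (rule eval_in_T1)
    show "eval ?e ?f \<bullet> j = eval e x \<bullet> (s \<bullet> j)" if "j \<in> \<N>" for j
      using that assms(2) e by (simp add: has_ty_def)
  qed (use sl in auto)
qed

end

context idem_ultrafilter begin

lemma sat_IHT:
  assumes e: "env e"
  shows "sat e IHT"
proof -
  have "\<exists>x\<in>D T1. (\<forall>i\<in>\<N>. \<forall>j\<in>\<N>. i \<lhd> j \<longrightarrow> x \<bullet> i \<lhd> x \<bullet> j) \<and>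
      (\<forall>k\<in>\<N>. sat (push N k (push T1 x (push Seq c e))) (FS_homogeneous (Var Seq 0 \<cdot> Var N 0) (translate (Var T1 0) (Var N 0))))"
    if c: "c \<in> D Seq" and two: "\<forall>k\<in>\<N>. \<forall>n\<in>\<N>. c \<bullet> k \<bullet> n = \<zero> \<or> c \<bullet> k \<bullet> n = suc \<zero>" for c
  proof (rule color_classes[OF c])
    fix A
    assume A: "A \<in> D Seq" and A_U: "\<And>k. k \<in> \<N> \<Longrightarrow> U \<bullet> (A \<bullet> k) = \<zero>"
      and A_c: "\<And>k. k \<in> \<N> \<Longrightarrow> (\<forall>n\<in>\<N>. A \<bullet> k \<bullet> n = c \<bullet> k \<bullet> n) \<or> (\<forall>n\<in>\<N>. A \<bullet> k \<bullet> n = csg (c \<bullet> k \<bullet> n))"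
    \<comment> \<open>The construction needs the stars of all color classes as one element of the
      model, so the defining term of \<open>star\<close> is repeated with k as a variable.\<close>
    obtain S where S: "S \<in> D Seq" and S_star: "\<And>k. k \<in> \<N> \<Longrightarrow> S \<bullet> k = star (A \<bullet> k)"
    proof -
      let ?t = "max_tm (Var Seq 0 \<cdot> Var N 1 \<cdot> Var N 0) (Var T2 0 \<cdot> translate (Var Seq 0 \<cdot> Var N 1) (Var N 0))"
      obtain S where S: "S \<in> D Seq"
        and ap: "\<And>k n. k \<in> \<N> \<Longrightarrow> n \<in> \<N> \<Longrightarrow> S \<bullet> k \<bullet> n = eval (push N n (push N k (push Seq A (push T2 U env0)))) ?t"
        by (rule comprehension2[of ?t "push Seq A (push T2 U env0)"]) (use A in \<open>auto simp: has_ty_def\<close>)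
      have "S \<bullet> k = star (A \<bullet> k)" if "k \<in> \<N>" for k
        by (rule fun_eqI) (use that S A in \<open>auto simp: ap star_ap has_ty_def\<close>)
      then show thesis using that S by blast
    qed
    show ?thesis
    proof (rule iterated_hindman[OF S])
      show "\<forall>k\<in>\<N>. U \<bullet> (S \<bullet> k) = \<zero>" using A A_U by (simp add: S_star star_U)
      show "\<forall>k\<in>\<N>. \<forall>v\<in>\<N>. S \<bullet> k \<bullet> v = \<zero> \<longrightarrow> U \<bullet> tr (S \<bullet> k) v = \<zero>"
        using A by (simp add: S_star star_translate_U)
      fix x
      assume x: "x \<in> D T1" and asc: "\<And>i j. i \<in> \<N> \<Longrightarrow> j \<in> \<N> \<Longrightarrow> i \<lhd> j \<Longrightarrow> x \<bullet> i \<lhd> x \<bullet> j"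
        and FS: "\<And>k s f l. k \<in> \<N> \<Longrightarrow> s \<in> D T1 \<Longrightarrow> f \<in> D T1 \<Longrightarrow> l \<in> \<N> \<Longrightarrow>
          (\<And>j. j \<in> \<N> \<Longrightarrow> j \<lhd> l \<Longrightarrow> s \<bullet> j \<lhd> s \<bullet> suc j) \<Longrightarrow>
          (\<And>j. j \<in> \<N> \<Longrightarrow> f \<bullet> j = x \<bullet> (s \<bullet> j \<oplus> k)) \<Longrightarrow> S \<bullet> k \<bullet> su f l = \<zero>"
      have "sat (push N k (push T1 x (push Seq c e))) (FS_homogeneous (Var Seq 0 \<cdot> Var N 0) (translate (Var T1 0) (Var N 0)))"
        (is "sat ?e (FS_homogeneous ?c ?x)") if k: "k \<in> \<N>" for k
      proof -
        have e': "env ?e" using e c x k by simp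
        have x_ty: "lift_tm N (lift_tm N ?x) \<Colon> T1" by (simp add: has_ty_def)
        \<comment> \<open>If the chosen class is c_k itself, its members have color 0. If it is the
          complement, their color is nonzero, hence 1 because c_k takes only two values.\<close>
        obtain i where i: "i \<in> \<N>" and A_i: "\<And>y. y \<in> \<N> \<Longrightarrow> A \<bullet> k \<bullet> y = \<zero> \<Longrightarrow> c \<bullet> k \<bullet> y = i"
        proof (cases "\<forall>n\<in>\<N>. A \<bullet> k \<bullet> n = c \<bullet> k \<bullet> n")
          case True
          then show thesis using that[of \<zero>] by simp
        next
          case False
          then have "\<forall>n\<in>\<N>. A \<bullet> k \<bullet> n = csg (c \<bullet> k \<bullet> n)" using A_c[OF k] by blast
          then have "c \<bullet> k \<bullet> y = suc \<zero>" if "y \<in> \<N>" "A \<bullet> k \<bullet> y = \<zero>" for y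
            using two k that by force
          then show thesis using that[of "suc \<zero>"] by simp
        qed
        have "c \<bullet> k \<bullet> y = i" if y: "y \<in> \<N>"
          and sat: "sat (push N y (push N i ?e)) (in_FS (Var N 0) (lift_tm N (lift_tm N ?x)))" for y
        proof (rule sat_in_FS[OF sat x_ty])
          fix s l f
          assume s: "s \<in> D T1" and l: "l \<in> \<N>" and f: "f \<in> D T1"
            and s_less: "\<And>j. j \<in> \<N> \<Longrightarrow> j \<lhd> l \<Longrightarrow> s \<bullet> j \<lhd> s \<bullet> suc j"
            and f_ap: "\<And>j. j \<in> \<N> \<Longrightarrow>
              f \<bullet> j = eval (push N y (push N i ?e)) (lift_tm N (lift_tm N ?x)) \<bullet> (s \<bullet> j)"
            and y_su: "eval (push N y (push N i ?e)) (Var N 0) = su f l"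
          have "f \<bullet> j = x \<bullet> (s \<bullet> j \<oplus> k)" if "j \<in> \<N>" for j
            using f_ap[OF that] that s k x e' by simp
          then have "S \<bullet> k \<bullet> y = \<zero>" using FS[OF k s f l s_less] y_su by simp
          then show "c \<bullet> k \<bullet> y = i" using A_i k y A by (simp add: S_star star_zero_iff)
        qed (use e' i y in auto)
        then show ?thesis using i by (auto simp: FS_homogeneous_def Let_def)
      qed
      then show ?thesis using x asc by blast
    qed
  qed
  then show ?thesis by (simp add: IHT_def Let_def strictly_ascending_def)
qed

end

lemma wff_U_idem: "wff U_idem"
  by (auto simp: U_idem_def Let_def mem_def has_ty_def)

lemma wff_in_FS: "y \<Colon> N \<Longrightarrow> x \<Colon> T1 \<Longrightarrow> wff (in_FS y x)"
  by (simp add: in_FS_def Let_def has_ty_def)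

lemma wff_IHT: "wff IHT"
  by (simp add: IHT_def Let_def strictly_ascending_def FS_homogeneous_def wff_in_FS has_ty_def)

theorem theorem7: "RCA0_omega \<turnstile> U_idem \<^bold>\<longrightarrow> IHT"
proof (rule completeness)
  show "wff (U_idem \<^bold>\<longrightarrow> IHT)" by (simp add: wff_U_idem wff_IHT)
  fix D :: "ty \<Rightarrow> tm set" and ap I e
  assume "rca_model D ap I" and e: "ext_structure.env D e"
  then interpret rca_model D ap I by simp
  show "sat e (U_idem \<^bold>\<longrightarrow> IHT)"
    using idem_ultrafilter_exists[OF e] idem_ultrafilter.sat_IHT[OF _ e] by auto
qed

end
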